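(* Let $u \in \mathrm{Sp}(V)$ be unipotent, with orthogonal decomposition $$V \downarrow K[u] = \sum_{1 \leq i \leq t} W(m_i) \perp \sum_{1 \leq j \leq s} V(2k_j).$$ Denote by $\alpha \geq 0$ the largest integer such that $2^{\alpha} \mid m_i,k_j$ for all $i$ and $j$. Then $$\mathfrak{g}_{sc} \cong V_{2^{\alpha}} \oplus V' \quad\text{and}\quad \mathfrak{g}_{sc}/Z(\mathfrak{g}_{sc}) \cong V_{2^{\alpha}-1} \oplus V'$$ for some $K[u]$-module $V'$.
   Context: $K$ is an algebraically closed field of characteristic two. $V$ is a $K$-vector space of dimension $2\ell$ with a non-degenerate alternating bilinear form $b$; $G_{sc} = \mathrm{Sp}(V)$ and $\mathfrak{g}_{sc} = \mathfrak{sp}(V)$ its Lie algebra with center $Z(\mathfrak{g}_{sc})$; $G_{sc}$ acts on $\mathfrak{g}_{sc}$ by conjugation. $K[u]$ is the group algebra of $\langle u\rangle$. $V_d$ denotes the $d$-dimensional $K[u]$-module on which $u$ acts as a single $d\times d$ unipotent Jordan block; $V_0 = 0$. Every unipotent $u\in \mathrm{Sp}(V)$ admits a decomposition of $V$ as an orthogonal direct sum of $u$-invariant subspaces, each isomorphic (by a $u$-equivariant isometry) to one of the following bilinear modules; $V \downarrow K[u] = \sum W(m_i)\perp\sum V(2k_j)$ denotes such a decomposition (possibly with $t=0$ or $s=0$), with $m_i, k_j \geq 1$. In both definitions the space has basis $v_1,\dots,v_n$, $n=2m$, with $b(v_i,v_j)=1$ if $i+j=n+1$ and $0$ otherwise.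 - $V(2m)$, $m \ge 1$: $uv_1=v_1$; $uv_i=v_i+v_{i-1}+\cdots+v_1$ for $1<i\le m+1$; $uv_i=v_i+v_{i-1}$ for $m+1<i\le n$. - $W(m)$, $m\ge1$: $uv_1=v_1$; $uv_i=v_i+v_{i-1}+\cdots+v_1$ for $1<i\le m$; $uv_{m+1}=v_{m+1}$; $uv_i=v_i+v_{i-1}$ for $m+1<i\le n$. *)

theory Defs
  imports
    "Jordan_Normal_Form.Jordan_Normal_Form"
    "Jordan_Normal_Form.VS_Connect"
    "HOL-Algebra.AbelCoset"
    "HOL-Computational_Algebra.Polynomial"
begin

text \<open>
  The field is a type of class \<open>field\<close>, and \<open>V\<close> is a whole type with scalar multiplication
  \<open>scale\<close>.
\<close>

locale symplectic_space = finite_dimensional_vector_space scale Basis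
  for scale :: "'k::field \<Rightarrow> 'v::ab_group_add \<Rightarrow> 'v" and Basis :: "'v set" +
  fixes b :: "'v \<Rightarrow> 'v \<Rightarrow> 'k"
  assumes linear_left: "Vector_Spaces.linear scale (*) (\<lambda>v. b v w)"
    and linear_right: "Vector_Spaces.linear scale (*) (\<lambda>w. b v w)"
    and alternating: "b v v = 0"
    and nondegenerate: "(\<And>w. b v w = 0) \<Longrightarrow> v = 0"

definition Sp :: "('k::field \<Rightarrow> 'v::ab_group_add \<Rightarrow> 'v) \<Rightarrow> ('v \<Rightarrow> 'v \<Rightarrow> 'k) \<Rightarrow> ('v \<Rightarrow> 'v) set" where
  "Sp scale b =
     {g. Vector_Spaces.linear scale scale g \<and> bij g \<and> (\<forall>v w. b (g v) (g w) = b v w)}"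

definition unipotent :: "('v::ab_group_add \<Rightarrow> 'v) \<Rightarrow> bool" where
  "unipotent g \<longleftrightarrow> (\<exists>n. \<forall>v. ((\<lambda>x. g x - x) ^^ n) v = 0)"

definition sp :: "('k::field \<Rightarrow> 'v::ab_group_add \<Rightarrow> 'v) \<Rightarrow> ('v \<Rightarrow> 'v \<Rightarrow> 'k) \<Rightarrow> ('v \<Rightarrow> 'v) set" where
  "sp scale b =
     {X. Vector_Spaces.linear scale scale X \<and> (\<forall>v w. b (X v) w + b v (X w) = 0)}"

text \<open>The center of a Lie algebra of endomorphisms with bracket \<open>XY - YX\<close>.\<close>

definition lie_center :: "('v::ab_group_add \<Rightarrow> 'v) set \<Rightarrow> ('v \<Rightarrow> 'v) set" where
  "lie_center L = {X \<in> L. \<forall>Y\<in>L. \<forall>v. X (Y v) - Y (X v) = 0}"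

text \<open>
  A module over the group algebra of the cyclic group \<open>\<langle>u\<rangle>\<close> is encoded as a vector space together
  with the operator \<open>act\<close> by which the generator \<open>u\<close> acts.  The last condition in
  \<open>group_algebra_module\<close> says that \<open>u\<^sup>n \<mapsto> act\<^sup>n\<close> is well defined on \<open>\<langle>u\<rangle>\<close>.  As usual for HOL-Algebra
  modules, the record fields \<open>mult\<close> and \<open>one\<close> carry no meaning.
\<close>

record ('k, 'a) umodule = "('k, 'a) module" +
  act :: "'a \<Rightarrow> 'a"

definition group_algebra_module :: "('v \<Rightarrow> 'v) \<Rightarrow> ('k::field, 'a) umodule \<Rightarrow> bool" where
  "group_algebra_module u M \<longleftrightarrow>
     Module.module (class_ring :: 'k ring) M \<and>
     act M \<in> LinearCombinations.module_hom (class_ring :: 'k ring) M M \<and>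
     bij_betw (act M) (carrier M) (carrier M) \<and>
     (\<forall>n. u ^^ n = id \<longrightarrow> (\<forall>x\<in>carrier M. (act M ^^ n) x = x))"

definition umodule_iso :: "('k::field, 'a) umodule \<Rightarrow> ('k, 'c) umodule \<Rightarrow> bool" where
  "umodule_iso M N \<longleftrightarrow>
     (\<exists>f \<in> LinearCombinations.module_hom (class_ring :: 'k ring) M N.
        bij_betw f (carrier M) (carrier N) \<and> (\<forall>x\<in>carrier M. f (act M x) = act N (f x)))"

definition umodule_sum ::
  "('k::field, 'a) umodule \<Rightarrow> ('k, 'c) umodule \<Rightarrow> ('k, 'a \<times> 'c) umodule" where
  "umodule_sum M N =
     Module.module.extend (direct_sum M N)
       (umodule.fields (\<lambda>x. (act M (fst x), act N (snd x))))"

text \<open>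
  The quotient by a \<open>u\<close>-stable subspace \<open>Z\<close>.  Translating by \<open>Z\<close> in \<open>smult\<close> and \<open>act\<close> makes the
  results full cosets, also for the scalar 0.
\<close>

definition umodule_quotient ::
  "('k::field, 'a) umodule \<Rightarrow> 'a set \<Rightarrow> ('k, 'a set) umodule" where
  "umodule_quotient M Z =
     \<lparr> carrier = a_rcosets\<^bsub>M\<^esub> Z, mult = undefined, one = undefined,
       zero = Z,
       add = set_add M,
       smult = (\<lambda>c C. \<Union>x\<in>C. Z +>\<^bsub>M\<^esub> (c \<odot>\<^bsub>M\<^esub> x)),
       act = (\<lambda>C. \<Union>x\<in>C. Z +>\<^bsub>M\<^esub> (act M x)) \<rparr>"

definition jordan_module :: "nat \<Rightarrow> ('k::field, 'k vec) umodule" where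
  "jordan_module d =
     Module.module.extend (module_vec TYPE('k) d)
       (umodule.fields (\<lambda>v. jordan_block d 1 *\<^sub>v v))"

definition sp_module ::
  "('k::field \<Rightarrow> 'v::ab_group_add \<Rightarrow> 'v) \<Rightarrow> ('v \<Rightarrow> 'v \<Rightarrow> 'k) \<Rightarrow> ('v \<Rightarrow> 'v) \<Rightarrow>
     ('k, 'v \<Rightarrow> 'v) umodule" where
  "sp_module scale b u =
     \<lparr> carrier = sp scale b, mult = undefined, one = undefined,
       zero = (\<lambda>v. 0),
       add = (\<lambda>X Y v. X v + Y v),
       smult = (\<lambda>c X v. scale c (X v)),
       act = (\<lambda>X. u \<circ> X \<circ> inv_into UNIV u) \<rparr>"

text \<open>
  A \<open>u\<close>-invariant subspace \<open>U\<close> is isometric, \<open>u\<close>-equivariantly, to \<open>V(2m)\<close> or \<open>W(m)\<close> iff it has a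
  basis \<open>x\<^sub>1, \<dots>, x\<^sub>n\<close>, \<open>n = 2m\<close>, satisfying the defining relations of that bilinear module.
\<close>

definition hyperbolic_basis ::
  "('k::field \<Rightarrow> 'v::ab_group_add \<Rightarrow> 'v) \<Rightarrow> ('v \<Rightarrow> 'v \<Rightarrow> 'k) \<Rightarrow> 'v set \<Rightarrow> nat \<Rightarrow> (nat \<Rightarrow> 'v) \<Rightarrow> bool"
  where
  "hyperbolic_basis scale b U n x \<longleftrightarrow>
     inj_on x {1..n} \<and>
     \<not> Modules.module.dependent scale (x ` {1..n}) \<and>
     Modules.module.span scale (x ` {1..n}) = U \<and>
     (\<forall>i\<in>{1..n}. \<forall>j\<in>{1..n}. b (x i) (x j) = (if i + j = n + 1 then 1 else 0))"

definition is_V ::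
  "('k::field \<Rightarrow> 'v::ab_group_add \<Rightarrow> 'v) \<Rightarrow> ('v \<Rightarrow> 'v \<Rightarrow> 'k) \<Rightarrow> ('v \<Rightarrow> 'v) \<Rightarrow> nat \<Rightarrow> 'v set \<Rightarrow> bool"
  where
  "is_V scale b u m U \<longleftrightarrow>
     (\<exists>x. hyperbolic_basis scale b U (2 * m) x \<and>
        u (x 1) = x 1 \<and>
        (\<forall>i. 1 < i \<and> i \<le> m + 1 \<longrightarrow> u (x i) = (\<Sum>j=1..i. x j)) \<and>
        (\<forall>i. m + 1 < i \<and> i \<le> 2 * m \<longrightarrow> u (x i) = x i + x (i - 1)))"

definition is_W ::
  "('k::field \<Rightarrow> 'v::ab_group_add \<Rightarrow> 'v) \<Rightarrow> ('v \<Rightarrow> 'v \<Rightarrow> 'k) \<Rightarrow> ('v \<Rightarrow> 'v) \<Rightarrow> nat \<Rightarrow> 'v set \<Rightarrow> bool"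
  where
  "is_W scale b u m U \<longleftrightarrow>
     (\<exists>x. hyperbolic_basis scale b U (2 * m) x \<and>
        u (x 1) = x 1 \<and>
        (\<forall>i. 1 < i \<and> i \<le> m \<longrightarrow> u (x i) = (\<Sum>j=1..i. x j)) \<and>
        u (x (m + 1)) = x (m + 1) \<and>
        (\<forall>i. m + 1 < i \<and> i \<le> 2 * m \<longrightarrow> u (x i) = x i + x (i - 1)))"

definition orthogonal_direct_sum ::
  "('k::field \<Rightarrow> 'v::ab_group_add \<Rightarrow> 'v) \<Rightarrow> ('v \<Rightarrow> 'v \<Rightarrow> 'k) \<Rightarrow> 'i set \<Rightarrow> ('i \<Rightarrow> 'v set) \<Rightarrow> bool"
  where
  "orthogonal_direct_sum scale b I U \<longleftrightarrow>
     (\<forall>i\<in>I. Modules.module.subspace scale (U i)) \<and>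
     (\<forall>i\<in>I. \<forall>j\<in>I. i \<noteq> j \<longrightarrow> (\<forall>x\<in>U i. \<forall>y\<in>U j. b x y = 0)) \<and>
     (\<forall>v. \<exists>!f. (\<forall>i\<in>I. f i \<in> U i) \<and> (\<forall>i. i \<notin> I \<longrightarrow> f i = 0) \<and> v = (\<Sum>i\<in>I. f i))"

text \<open>\<open>V \<down> K[u] = W(m\<^sub>1) + \<dots> + W(m\<^sub>t) + V(2k\<^sub>1) + \<dots> + V(2k\<^sub>s)\<close>, orthogonally.\<close>

definition orthogonal_decomposition ::
  "('k::field \<Rightarrow> 'v::ab_group_add \<Rightarrow> 'v) \<Rightarrow> ('v \<Rightarrow> 'v \<Rightarrow> 'k) \<Rightarrow> ('v \<Rightarrow> 'v) \<Rightarrow>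
     nat \<Rightarrow> (nat \<Rightarrow> nat) \<Rightarrow> nat \<Rightarrow> (nat \<Rightarrow> nat) \<Rightarrow> bool" where
  "orthogonal_decomposition scale b u t m s k \<longleftrightarrow>
     (\<exists>U :: nat + nat \<Rightarrow> 'v set.
        orthogonal_direct_sum scale b (Inl ` {1..t} \<union> Inr ` {1..s}) U \<and>
        (\<forall>i\<in>Inl ` {1..t} \<union> Inr ` {1..s}. u ` U i \<subseteq> U i) \<and>
        (\<forall>i\<in>{1..t}. is_W scale b u (m i) (U (Inl i))) \<and>
        (\<forall>j\<in>{1..s}. is_V scale b u (k j) (U (Inr j))))"

end

theory Submission
  imports Defs "HOL-Library.Function_Algebras"
begin

text \<open>
  Write \<open>q = 2\<^sup>\<alpha>\<close>, \<open>y = u - 1\<close> and let \<open>N X = u X u\<inverse> - X\<close> on \<open>M = sp V\<close>.  The center is the line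
  spanned by the identity, which \<open>N\<close> kills.  If a fixed vector \<open>z\<close> lies in \<open>N\<^sup>h M\<close> but not in \<open>N\<^sup>h\<^sup>+\<^sup>1 M\<close>,
  it is the socle of a direct summand isomorphic to a Jordan block of size \<open>h + 1\<close>, and factoring
  out \<open>z\<close> shortens this block by one; so the claim is that \<open>h = q - 1\<close> for \<open>z = 1\<close>.

  In characteristic two \<open>N\<^sup>q\<close> is \<open>X \<mapsto> u\<^sup>q X u\<^sup>-\<^sup>q - X\<close>, so \<open>1 = N\<^sup>q X\<close> amounts to a symmetric form
  \<open>B(v, w) = b(X v, w)\<close> with \<open>B(u\<^sup>q v, u\<^sup>q w) = B(v, w) + b(v, w)\<close>.  On a summand \<open>W(m)\<close> or \<open>V(2m)\<close> with
  \<open>m / q\<close> odd there is none: for \<open>W(m)\<close> because an invariant element of the symmetric square of \<open>V\<close>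
  pairs with \<open>b\<close> to \<open>m / q\<close>, for \<open>V(2m)\<close> by a computation on the cyclic \<open>u\<^sup>q\<close>-module generated by
  the last basis vector.  Conversely \<open>1 = N\<^sup>q\<^sup>-\<^sup>1 X\<close>, where \<open>X\<close> is the self-adjoint operator that
  sends \<open>y\<^sup>j x\<close> to \<open>y\<^sup>j\<^sup>' x\<close>, \<open>j'\<close> being \<open>j\<close> rounded down to a multiple of \<open>q\<close>, for the last basis vector
  \<open>x\<close> of each summand and \<open>j\<close> below half its dimension: this rests on
  \<open>N\<^sup>q\<^sup>-\<^sup>1 X = (\<Sum>i<q. y\<^sup>i X y\<^sup>q\<^sup>-\<^sup>1\<^sup>-\<^sup>i) u\<^sup>1\<^sup>-\<^sup>q\<close>.
\<close>

section \<open>Commuting operators in characteristic two\<close>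

lemma additive_funpow:
  fixes f :: "'a::ab_group_add \<Rightarrow> 'a"
  shows "additive f \<Longrightarrow> additive (f ^^ n)"
  by (induction n) (auto simp: additive_def)

text \<open>Squaring \<open>L + R\<close> cancels the two cross terms, so the induction passes from
  \<open>L\<close>, \<open>R\<close> to the commuting pair of their squares.\<close>

lemma frobenius_funpow:
  fixes L R :: "'a::ab_group_add \<Rightarrow> 'a"
  assumes "additive L" "additive R" "\<And>x. L (R x) = R (L x)" "\<And>x::'a. x + x = 0"
  shows "((\<lambda>x. L x + R x) ^^ (2 ^ a)) x = (L ^^ (2 ^ a)) x + (R ^^ (2 ^ a)) x"
  using assms(1-3)
proof (induction a arbitrary: L R x)
  case 0
  then show ?case by simp
next
  case (Suc a)
  interpret L: additive L by fact
  interpret R: additive R by fact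
  have sq: "(\<lambda>x. L x + R x) ^^ 2 = (\<lambda>x. (L ^^ 2) x + (R ^^ 2) x)"
  proof
    fix x
    have "((\<lambda>x. L x + R x) ^^ 2) x = L (L x) + R (R x) + (L (R x) + L (R x))"
      by (simp add: numeral_2_eq_2 L.add R.add Suc.prems(3) ac_simps)
    then show "((\<lambda>x. L x + R x) ^^ 2) x = (L ^^ 2) x + (R ^^ 2) x"
      by (simp add: assms(4) numeral_2_eq_2)
  qed
  have "additive (L ^^ 2)" "additive (R ^^ 2)"
    by (auto simp: additive_def numeral_2_eq_2 L.add R.add)
  then have "((\<lambda>x. (L ^^ 2) x + (R ^^ 2) x) ^^ (2 ^ a)) x
      = ((L ^^ 2) ^^ (2 ^ a)) x + ((R ^^ 2) ^^ (2 ^ a)) x"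
    by (rule Suc.IH) (simp add: numeral_2_eq_2 Suc.prems(3))
  then show ?case
    by (simp add: sq[symmetric] funpow_mult mult.commute)
qed

text \<open>All binomial coefficients with upper entry \<open>2 ^ a - 1\<close> are odd. The
  induction bypasses them: for \<open>q = 2 ^ a\<close>, applying \<open>L ^^ q\<close> and
  \<open>R ^^ q\<close> to the sum for \<open>q\<close> gives the upper and the lower half of the
  sum for \<open>2 * q\<close>.\<close>

lemma frobenius_funpow_pred:
  fixes L R :: "'a::ab_group_add \<Rightarrow> 'a"
  assumes L: "additive L" and R: "additive R"
    and comm: "\<And>x. L (R x) = R (L x)" and char: "\<And>x::'a. x + x = 0"
  shows "((\<lambda>x. L x + R x) ^^ (2 ^ a - 1)) x
    = (\<Sum>i<2 ^ a. (L ^^ i) ((R ^^ (2 ^ a - 1 - i)) x))"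
proof (induction a)
  case 0
  then show ?case by simp
next
  case (Suc a)
  define q :: nat where "q = 2 ^ a"
  have q: "q \<ge> 1" by (simp add: q_def)
  have comm_pow: "(R ^^ i) ((L ^^ j) z) = (L ^^ j) ((R ^^ i) z)" for i j z
  proof -
    have "L ((R ^^ i) z) = (R ^^ i) (L z)" for z by (induction i) (simp_all add: comm)
    note this[symmetric, simp]
    show ?thesis by (induction j) simp_all
  qed
  have S: "additive (L ^^ q)" "additive (R ^^ q)"
    using L R by (auto intro: additive_funpow)
  have "((\<lambda>x. L x + R x) ^^ (2 ^ Suc a - 1)) x
      = ((\<lambda>x. L x + R x) ^^ q) (((\<lambda>x. L x + R x) ^^ (q - 1)) x)"
    using q funpow_add[of q "q - 1" "\<lambda>x. L x + R x"] by (simp add: q_def mult_2)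
  also have "\<dots> = (\<Sum>i<q. (L ^^ (q + i)) ((R ^^ (q - 1 - i)) x))
      + (\<Sum>i<q. (L ^^ i) ((R ^^ q) ((R ^^ (q - 1 - i)) x)))"
    using Suc S additive.sum[of "L ^^ q" _ "{..<q}"] additive.sum[of "R ^^ q" _ "{..<q}"]
    by (simp add: q_def frobenius_funpow[OF L R comm char] funpow_add comm_pow o_def)
  also have "(\<Sum>i<q. (L ^^ (q + i)) ((R ^^ (q - 1 - i)) x))
      = (\<Sum>i=q..<2*q. (L ^^ i) ((R ^^ (2 * q - 1 - i)) x))"
    by (rule sum.reindex_bij_witness[of _ "\<lambda>i. i - q" "\<lambda>i. q + i"]) auto
  also have "(\<Sum>i<q. (L ^^ i) ((R ^^ q) ((R ^^ (q - 1 - i)) x)))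
      = (\<Sum>i=0..<q. (L ^^ i) ((R ^^ (2 * q - 1 - i)) x))"
  proof (rule sum.cong)
    fix i assume "i \<in> {0..<q}"
    then have "2 * q - 1 - i = q + (q - 1 - i)" by auto
    then show "(L ^^ i) ((R ^^ q) ((R ^^ (q - 1 - i)) x)) = (L ^^ i) ((R ^^ (2 * q - 1 - i)) x)"
      by (simp only: funpow_add comp_apply)
  qed auto
  also have "(\<Sum>i=q..<2*q. (L ^^ i) ((R ^^ (2 * q - 1 - i)) x))
      + (\<Sum>i=0..<q. (L ^^ i) ((R ^^ (2 * q - 1 - i)) x))
      = (\<Sum>i<2*q. (L ^^ i) ((R ^^ (2 * q - 1 - i)) x))"
    by (subst add.commute, subst sum.atLeastLessThan_concat) (auto simp: atLeast0LessThan)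
  finally show ?case by (simp add: q_def)
qed

section \<open>Functionals dual to a nilpotent chain\<close>

context vector_space
begin

lemma linear_funpow:
  assumes "Vector_Spaces.linear scale scale f"
  shows "Vector_Spaces.linear scale scale (f ^^ n)"
proof (induction n)
  case 0
  show ?case by (simp add: linear_id[unfolded id_def])
next
  case (Suc n)
  with assms show ?case by (simp add: Vector_Spaces.linear_iff)
qed

text \<open>A functional that vanishes on the image of \<open>N ^^ Suc h\<close> and is 1 at
  \<open>(N ^^ h) w\<close> exists by extending a basis of that image. Subtracting multiples of its
  composites with powers of \<open>N\<close> then kills the remaining chain values one by one, from
  \<open>h - 1\<close> downwards, and keeps the vanishing on the image.\<close>

lemma dual_functional_of_chain:
  assumes N: "Vector_Spaces.linear scale scale N"
    and M: "subspace M" and NM: "N ` M \<subseteq> M" and w: "(N ^^ Suc h) w = 0"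
    and notin: "(N ^^ h) w \<notin> (N ^^ Suc h) ` M"
  obtains \<phi> where "Vector_Spaces.linear scale (*) \<phi>" "\<And>v. v \<in> M \<Longrightarrow> \<phi> ((N ^^ Suc h) v) = 0"
    "\<And>i. i \<le> h \<Longrightarrow> \<phi> ((N ^^ i) w) = (if i = h then 1 else 0)"
proof -
  interpret p: vector_space_pair scale "(*) :: 'a \<Rightarrow> 'a \<Rightarrow> 'a"
    by unfold_locales (auto simp: algebra_simps)
  note funpow.simps [simp del]
  let ?S = "(N ^^ Suc h) ` M"
  have "subspace ?S"
    by (intro module_hom.subspace_image[OF Vector_Spaces.linear.axioms(3)[OF linear_funpow]] N M)
  then have S: "span ?S = ?S" by simp
  obtain B where B: "B \<subseteq> ?S" "independent B" "span B = span ?S"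
    using maximal_independent_subset[of ?S] span_mono[of _ ?S] span_minimal
    by (metis S \<open>subspace ?S\<close> subset_antisym)
  have ind: "independent (insert ((N ^^ h) w) B)"
    by (rule independent_insertI[OF _ B(2)]) (simp only: B(3) S notin not_False_eq_True)
  define \<phi>\<^sub>0 where "\<phi>\<^sub>0 = p.construct (insert ((N ^^ h) w) B) (\<lambda>v. if v = (N ^^ h) w then 1 else 0)"
  have lin0: "Vector_Spaces.linear scale (*) \<phi>\<^sub>0"
    unfolding \<phi>\<^sub>0_def by (rule p.linear_construct[OF ind])
  have one0: "\<phi>\<^sub>0 ((N ^^ h) w) = 1"
    unfolding \<phi>\<^sub>0_def by (subst p.construct_basis[OF ind]) auto
  have zero0: "\<phi>\<^sub>0 ((N ^^ Suc h) v) = 0" if "v \<in> M" for v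
  proof (rule p.linear_eq_0_on_span[OF lin0, of B])
    show "\<phi>\<^sub>0 x = 0" if "x \<in> B" for x
      unfolding \<phi>\<^sub>0_def using that B notin by (subst p.construct_basis[OF ind]) auto
    show "(N ^^ Suc h) v \<in> span B" unfolding B(3) S using that by (rule imageI)
  qed
  have van: "(N ^^ i) w = 0" if i: "i > h" for i
  proof -
    obtain d where d: "i = Suc h + d"
      using le_Suc_ex[OF Suc_leI[OF i]] by blast
    show ?thesis
      unfolding d add.commute[of "Suc h" d] funpow_add comp_apply w
      by (rule module_hom.zero[OF Vector_Spaces.linear.axioms(3)[OF linear_funpow[OF N]]])
  qed
  have "\<exists>\<phi>. Vector_Spaces.linear scale (*) \<phi> \<and> (\<forall>v\<in>M. \<phi> ((N ^^ Suc h) v) = 0) \<and>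
      (\<forall>i. h - s \<le> i \<and> i \<le> h \<longrightarrow> \<phi> ((N ^^ i) w) = (if i = h then 1 else 0))"
    if "s \<le> h" for s
    using that
  proof (induction s)
    case 0
    show ?case using lin0 one0 zero0 by (intro exI[of _ \<phi>\<^sub>0]) auto
  next
    case (Suc s)
    from Suc.IH[OF Suc_leD[OF Suc.prems]] obtain \<phi> where lin: "Vector_Spaces.linear scale (*) \<phi>"
      and zero: "\<And>v. v \<in> M \<Longrightarrow> \<phi> ((N ^^ Suc h) v) = 0"
      and ind: "\<And>i. h - s \<le> i \<Longrightarrow> i \<le> h \<Longrightarrow> \<phi> ((N ^^ i) w) = (if i = h then 1 else 0)"
      by blast
    define c where "c = \<phi> ((N ^^ (h - Suc s)) w)"
    \<comment> \<open>kills the chain at \<open>h - Suc s\<close>; above it only the already known values enter\<close>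
    define \<psi> where "\<psi> = (\<lambda>v. \<phi> v - c * \<phi> ((N ^^ Suc s) v))"
    have "Vector_Spaces.linear scale (*) (\<phi> \<circ> (N ^^ Suc s))"
      using linear_funpow[OF N] lin by (rule Vector_Spaces.linear_compose)
    then have "Vector_Spaces.linear scale (*) \<psi>"
      unfolding \<psi>_def using p.linear_compose_sub[OF lin p.linear_compose_scale_right]
      by (simp only: comp_def)
    moreover have "\<psi> ((N ^^ Suc h) v) = 0" if "v \<in> M" for v
    proof -
      have "(N ^^ Suc s) ((N ^^ Suc h) v) = (N ^^ Suc h) ((N ^^ Suc s) v)"
        using fun_cong[OF funpow_add[of "Suc s" "Suc h" N]] fun_cong[OF funpow_add[of "Suc h" "Suc s" N]]
        by (simp only: comp_apply add.commute[of "Suc s"])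
      moreover have "(N ^^ j) v \<in> M" for j
        using that NM by (induction j) (simp_all add: funpow.simps image_subset_iff)
      ultimately show ?thesis
        using zero that by (simp only: \<psi>_def) simp
    qed
    moreover have "\<psi> ((N ^^ i) w) = (if i = h then 1 else 0)" if i: "h - Suc s \<le> i" "i \<le> h" for i
    proof -
      have shift: "\<psi> ((N ^^ i) w) = \<phi> ((N ^^ i) w) - c * \<phi> ((N ^^ (Suc s + i)) w)"
        by (simp only: \<psi>_def funpow_add comp_apply)
      show ?thesis
      proof (cases "i = h - Suc s")
        case True
        then have "Suc s + i = h" "i \<noteq> h" "c = \<phi> ((N ^^ i) w)"
          using Suc.prems by (auto simp: c_def)
        then show ?thesis using ind[of h] by (simp only: shift) simp
      next
        case False
        then have "h - s \<le> i" "Suc s + i > h" using i Suc.prems by auto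
        then show ?thesis using ind[of i] i van[of "Suc s + i"] p.linear_0[OF lin]
          by (simp only: shift) simp
      qed
    qed
    ultimately show ?case by blast
  qed
  from this[of h] show ?thesis using that by (metis diff_self_eq_0 le_refl zero_le)
qed

end

section \<open>Modules with an operator\<close>

lemma umodule_sum_simps:
  "carrier (umodule_sum M N) = carrier M \<times> carrier N"
  "add (umodule_sum M N) = (\<lambda>v w. (add M (fst v) (fst w), add N (snd v) (snd w)))"
  "smult (umodule_sum M N) = (\<lambda>c v. (smult M c (fst v), smult N c (snd v)))"
  "act (umodule_sum M N) = (\<lambda>x. (act M (fst x), act N (snd x)))"
  by (simp_all add: umodule_sum_def direct_sum_def umodule.defs module.defs)

lemma jordan_module_simps:
  "carrier (jordan_module d) = carrier_vec d"
  "add (jordan_module d) = (+)"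
  "smult (jordan_module d) = (\<cdot>\<^sub>v)"
  "act (jordan_module d) = (\<lambda>v. jordan_block d 1 *\<^sub>v v)"
  by (simp_all add: jordan_module_def module_vec_def umodule.defs module.defs)

lemma jordan_block_mult_vec:
  fixes c :: "nat \<Rightarrow> 'a::comm_ring_1"
  shows "jordan_block d 1 *\<^sub>v vec d c = vec d (\<lambda>i. c i + (if Suc i < d then c (Suc i) else 0))"
proof (intro eq_vecI)
  fix i assume "i < dim_vec (vec d (\<lambda>i. c i + (if Suc i < d then c (Suc i) else 0)))"
  then have i: "i < d" by simp
  have "(jordan_block d 1 *\<^sub>v vec d c) $ i = (\<Sum>j=0..<d. jordan_block d 1 $$ (i, j) * c j)"
    using i by (simp add: scalar_prod_def)
  also have "\<dots> = (\<Sum>j=0..<d. (if i = j then c j else 0) + (if Suc i = j then c j else 0))"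
    using i by (intro sum.cong) auto
  also have "\<dots> = c i + (if Suc i < d then c (Suc i) else 0)"
    using i by (simp add: sum.distrib)
  finally show "(jordan_block d 1 *\<^sub>v vec d c) $ i
      = vec d (\<lambda>i. c i + (if Suc i < d then c (Suc i) else 0)) $ i"
    using i by simp
qed simp

text \<open>The common shape of \<open>sp_module\<close> and of the complement: zero and addition
  are those of the type, so that subspace and linearity lemmas apply to the carrier
  directly.\<close>

definition operator_module ::
  "('k::field \<Rightarrow> 'a::ab_group_add \<Rightarrow> 'a) \<Rightarrow> 'a set \<Rightarrow> ('a \<Rightarrow> 'a) \<Rightarrow> ('k, 'a) umodule" where
  "operator_module scale M f = \<lparr> carrier = M, mult = undefined, one = undefined, zero = 0,
     add = (+), smult = scale, act = f \<rparr>"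

lemma operator_module_simps [simp]:
  "carrier (operator_module scale M f) = M"
  "add (operator_module scale M f) = (+)"
  "smult (operator_module scale M f) = scale"
  "act (operator_module scale M f) = f"
  "zero (operator_module scale M f) = 0"
  by (simp_all add: operator_module_def)

context vector_space
begin

lemma module_operator_module:
  assumes "subspace M"
  shows "Module.module class_ring (operator_module scale M f)"
proof -
  have "abelian_group (operator_module scale M f)"
  proof (rule abelian_groupI)
    fix x assume x: "x \<in> carrier (operator_module scale M f)"
    show "\<exists>y\<in>carrier (operator_module scale M f). y \<oplus>\<^bsub>operator_module scale M f\<^esub> x
        = \<zero>\<^bsub>operator_module scale M f\<^esub>"
      using x subspace_neg[OF assms] by (intro bexI[of _ "- x"]) auto
  qed (use assms in \<open>auto simp: subspace_def add.assoc add.commute\<close>)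
  then show ?thesis
    using class_cring.cring_axioms assms
    by (simp add: Module.module_def module_axioms_def subspace_def scale_left_distrib
        scale_right_distrib class_field.field_axioms)
qed

text \<open>The first isomorphism theorem for \<open>umodule_quotient\<close>; the induced map
  evaluates \<open>F\<close> at a chosen representative.\<close>

lemma umodule_iso_quotientI:
  fixes P :: "('a, 'c) umodule"
  assumes M: "subspace M" and Z: "subspace Z" "Z \<subseteq> M" and f: "f ` M \<subseteq> M"
    and F: "F ` M = carrier P"
    and add: "\<And>x y. x \<in> M \<Longrightarrow> y \<in> M \<Longrightarrow> F (x + y) = F x \<oplus>\<^bsub>P\<^esub> F y"
    and smult: "\<And>c x. x \<in> M \<Longrightarrow> F (scale c x) = c \<odot>\<^bsub>P\<^esub> F x"
    and act: "\<And>x. x \<in> M \<Longrightarrow> F (f x) = act P (F x)"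
    and ker: "\<And>x y. x \<in> M \<Longrightarrow> y \<in> M \<Longrightarrow> F x = F y \<longleftrightarrow> x - y \<in> Z"
  shows "umodule_iso (umodule_quotient (operator_module scale M f) Z) P"
proof -
  let ?M = "operator_module scale M f"
  have coset: "Z +>\<^bsub>?M\<^esub> x = (\<lambda>z. z + x) ` Z" for x
    by (auto simp: a_r_coset_def')
  have cosets: "a_rcosets\<^bsub>?M\<^esub> Z = (\<lambda>x. (\<lambda>z. z + x) ` Z) ` M"
    by (auto simp: A_RCOSETS_def' coset)
  define G where "G C = F (SOME x. x \<in> C)" for C
  \<comment> \<open>Only constancy of \<open>F\<close> on a nonempty set is asked for, so this also
    evaluates the unions in the definition of the quotient without first showing that they are
    cosets.\<close>
  have G: "G C = c" if "C \<noteq> {}" "\<And>x. x \<in> C \<Longrightarrow> F x = c" for C c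
    unfolding G_def using that by (metis some_in_eq)
  have Z0: "Z \<noteq> {}" using Z subspace_0 by auto
  have inv: "F (z + x) = F x" if "z \<in> Z" "x \<in> M" for z x
    using that ker[of "z + x" x] Z M subspace_add by auto
  have Gc: "G ((\<lambda>z. z + x) ` Z) = F x" if "x \<in> M" for x
    using that Z0 inv by (intro G) auto
  show ?thesis
    unfolding umodule_iso_def
  proof (intro bexI[of _ G] conjI ballI)
    show "G \<in> module_hom class_ring (umodule_quotient ?M Z) P"
      unfolding module_hom_def umodule_quotient_def mem_Collect_eq
    proof (intro conjI allI impI, goal_cases)
      case 1
      show ?case using F Gc by (auto simp: cosets)
    next
      case (2 C D)
      then obtain x y where xy: "x \<in> M" "y \<in> M" "C = (\<lambda>z. z + x) ` Z" "D = (\<lambda>z. z + y) ` Z"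
        by (auto simp: cosets)
      have "F ((z + x) + (z' + y)) = F x \<oplus>\<^bsub>P\<^esub> F y" if "z \<in> Z" "z' \<in> Z" for z z'
        using that xy Z add[of "z + x" "z' + y"] inv M subspace_add by (auto simp: subset_iff)
      then have "G (C <+>\<^bsub>?M\<^esub> D) = F x \<oplus>\<^bsub>P\<^esub> F y"
        using Z0 by (intro G) (auto simp: set_add_def' xy)
      then show ?case using xy Gc by simp
    next
      case (3 c C)
      then obtain x where x: "x \<in> M" "C = (\<lambda>z. z + x) ` Z"
        by (auto simp: cosets)
      have "F (z + scale c (z' + x)) = c \<odot>\<^bsub>P\<^esub> F x" if "z \<in> Z" "z' \<in> Z" for z z'
        using that x Z smult[of "z' + x" c] inv M subspace_add subspace_scale
        by (auto simp: subset_iff)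
      then have "G (\<Union>x\<in>C. Z +>\<^bsub>?M\<^esub> (c \<odot>\<^bsub>?M\<^esub> x)) = c \<odot>\<^bsub>P\<^esub> F x"
        using Z0 by (intro G) (auto simp: coset x)
      then show ?case using x Gc by simp
    qed
    show "bij_betw G (carrier (umodule_quotient ?M Z)) (carrier P)"
      unfolding bij_betw_def umodule_quotient_def
    proof (intro conjI, goal_cases)
      case 1
      have "(\<lambda>z. z + x) ` Z = (\<lambda>z. z + y) ` Z" if "x - y \<in> Z" for x y
      proof -
        have "z + x \<in> (\<lambda>z. z + y) ` Z" if "z \<in> Z" for z
          using that \<open>x - y \<in> Z\<close> subspace_add[OF Z(1), of z "x - y"]
          by (intro image_eqI[of _ _ "z + (x - y)"]) auto
        moreover have "z + y \<in> (\<lambda>z. z + x) ` Z" if "z \<in> Z" for z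
          using that \<open>x - y \<in> Z\<close> subspace_diff[OF Z(1), of z "x - y"]
          by (intro image_eqI[of _ _ "z - (x - y)"]) auto
        ultimately show ?thesis by blast
      qed
      then show ?case by (auto simp: inj_on_def cosets Gc ker)
    next
      case 2
      show ?case using F by (auto simp: cosets image_image Gc)
    qed
    fix C assume "C \<in> carrier (umodule_quotient ?M Z)"
    then obtain x where x: "x \<in> M" "C = (\<lambda>z. z + x) ` Z"
      by (auto simp: umodule_quotient_def cosets)
    have "F (z + f (z' + x)) = act P (F x)" if "z \<in> Z" "z' \<in> Z" for z z'
      using that x Z act[of "z' + x"] inv M subspace_add f
      by (auto simp: subset_iff image_subset_iff)
    then have "G (\<Union>x\<in>C. Z +>\<^bsub>?M\<^esub> (act ?M x)) = act P (F x)"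
      using Z0 by (intro G) (auto simp: coset x)
    then show "G (act (umodule_quotient ?M Z) C) = act P (G C)"
      using x Gc by (simp add: umodule_quotient_def)
  qed
qed

end

section \<open>Splitting off a Jordan chain\<close>

context vector_space
begin

text \<open>The values \<open>\<phi> ((N ^^ i) v)\<close>, for \<open>i\<close> up to
  \<open>h\<close>, are coordinates along the chain of \<open>w\<close>, and their common kernel
  \<open>M'\<close> is a complement. Since \<open>\<phi>\<close> kills the image of
  \<open>N ^^ Suc h\<close>, applying \<open>N\<close> merely shifts these coordinates, which is the
  action of a Jordan block.\<close>

lemma jordan_chain_splits_off:
  assumes N: "Vector_Spaces.linear scale scale N"
    and M: "subspace M" and NM: "N ` M \<subseteq> M" and w: "w \<in> M" "(N ^^ Suc h) w = 0"
    and \<phi>: "Vector_Spaces.linear scale (*) \<phi>" "\<And>v. v \<in> M \<Longrightarrow> \<phi> ((N ^^ Suc h) v) = 0"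
      "\<And>i. i \<le> h \<Longrightarrow> \<phi> ((N ^^ i) w) = (if i = h then 1 else 0)"
  defines "M' \<equiv> {v \<in> M. \<forall>i\<le>h. \<phi> ((N ^^ i) v) = 0}"
  shows "subspace M'" "N ` M' \<subseteq> M'"
    "umodule_iso (operator_module scale M (\<lambda>v. v + N v))
      (umodule_sum (jordan_module (Suc h)) (operator_module scale M' (\<lambda>v. v + N v)))"
    "umodule_iso (umodule_quotient (operator_module scale M (\<lambda>v. v + N v)) (range (\<lambda>c. scale c ((N ^^ h) w))))
      (umodule_sum (jordan_module h) (operator_module scale M' (\<lambda>v. v + N v)))"
proof -
  interpret N: Vector_Spaces.linear scale scale N by fact
  interpret f: Vector_Spaces.linear scale "(*)" \<phi> by fact
  have pow_add: "(N ^^ i) (x + y) = (N ^^ i) x + (N ^^ i) y"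
    and pow_scale: "(N ^^ i) (scale c x) = scale c ((N ^^ i) x)"
    and pow_0: "(N ^^ i) 0 = 0" for i x y c
    by (induction i) (simp_all add: N.add N.scale N.zero)
  have pow_sum: "(N ^^ i) (sum g A) = (\<Sum>j\<in>A. (N ^^ i) (g j))" for i and g :: "nat \<Rightarrow> 'b" and A
    by (induction i) (simp_all add: N.sum)
  have pow_pow: "(N ^^ i) ((N ^^ j) x) = (N ^^ (i + j)) x" for i j x
    by (simp add: funpow_add)
  have pow_M: "(N ^^ i) x \<in> M" if "x \<in> M" for i x
    using that NM by (induction i) (auto simp: image_subset_iff)
  have van: "(N ^^ i) w = 0" if "h < i" for i
    using that pow_pow[of "i - Suc h" "Suc h" w] w(2) pow_0 by (simp del: funpow.simps)
  have \<phi>_van: "\<phi> ((N ^^ i) v) = 0" if "h < i" "v \<in> M" for i v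
    using \<phi>(2)[OF pow_M[OF that(2)], of "i - Suc h"] that pow_pow[of "Suc h" "i - Suc h" v]
    by (simp del: funpow.simps)
  \<comment> \<open>The projection onto the chain along \<open>M'\<close>: by duality the
    coefficient of \<open>(N ^^ j) w\<close> is read off by \<open>\<phi>\<close> after
    \<open>h - j\<close> further steps.\<close>
  define \<pi> where "\<pi> v = (\<Sum>j\<le>h. scale (\<phi> ((N ^^ (h - j)) v)) ((N ^^ j) w))" for v
  have \<phi>_chain: "\<phi> ((N ^^ i) (\<Sum>j\<le>h. scale (a j) ((N ^^ j) w))) = a (h - i)" if "i \<le> h" for a i
  proof -
    have "\<phi> ((N ^^ i) (\<Sum>j\<le>h. scale (a j) ((N ^^ j) w))) = (\<Sum>j\<le>h. a j * \<phi> ((N ^^ (i + j)) w))"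
      by (simp add: pow_sum pow_scale pow_pow f.sum f.scale)
    also have "\<dots> = (\<Sum>j\<le>h. if j = h - i then a j else 0)"
    proof (intro sum.cong refl)
      fix j assume "j \<in> {..h}"
      show "a j * \<phi> ((N ^^ (i + j)) w) = (if j = h - i then a j else 0)"
        using that \<phi>(3)[of "i + j"] van[of "i + j"] f.zero by (cases "i + j \<le> h") auto
    qed
    also have "\<dots> = a (h - i)" by simp
    finally show ?thesis .
  qed
  have \<pi>_M: "\<pi> v \<in> M" for v
    unfolding \<pi>_def using M w pow_M by (intro subspace_sum subspace_scale) auto
  have \<pi>_add: "\<pi> (x + y) = \<pi> x + \<pi> y" and \<pi>_scale: "\<pi> (scale c x) = scale c (\<pi> x)" for x y c
    by (simp_all add: \<pi>_def pow_add pow_scale f.add f.scale scale_left_distrib sum.distrib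
        scale_sum_right)
  have \<pi>_N: "\<pi> (N v) = N (\<pi> v)" if v: "v \<in> M" for v
  proof -
    have "N (\<pi> v) = (\<Sum>j\<le>h. scale (\<phi> ((N ^^ (h - j)) v)) ((N ^^ Suc j) w))"
      by (simp add: \<pi>_def N.sum N.scale)
    \<comment> \<open>The added term at \<open>j = 0\<close> vanishes because \<open>\<phi>\<close>
      kills the image of \<open>N ^^ Suc h\<close>; below, the term at \<open>Suc h\<close> is
      dropped because \<open>(N ^^ Suc h) w = 0\<close>.\<close>
    also have "\<dots> = (\<Sum>j\<le>Suc h. scale (\<phi> ((N ^^ (Suc h - j)) v)) ((N ^^ j) w))"
      using \<phi>(2)[OF v] by (subst sum.atMost_Suc_shift) (simp del: funpow.simps)
    also have "\<dots> = \<pi> (N v)"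
      using w(2) unfolding \<pi>_def
      by (simp add: Suc_diff_le funpow_Suc_right del: funpow.simps)
    finally show ?thesis by simp
  qed
  show M': "subspace M'"
    using M by (auto simp: subspace_def M'_def pow_add pow_scale pow_0 f.add f.scale f.zero)
  show NM': "N ` M' \<subseteq> M'"
  proof (safe)
    fix v assume v: "v \<in> M'"
    then have "v \<in> M" by (simp add: M'_def)
    have "\<phi> ((N ^^ i) (N v)) = 0" if "i \<le> h" for i
    proof -
      have "(N ^^ i) (N v) = (N ^^ Suc i) v" by (simp add: funpow_swap1)
      then show ?thesis
        using v \<phi>_van[of "Suc i" v] \<open>v \<in> M\<close> that
        by (cases "i = h") (auto simp: M'_def simp del: funpow.simps)
    qed
    then show "N v \<in> M'" using NM \<open>v \<in> M\<close> by (auto simp: M'_def)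
  qed
  have compl: "v - \<pi> v \<in> M'" if "v \<in> M" for v
  proof -
    have "\<phi> ((N ^^ i) (\<pi> v)) = \<phi> ((N ^^ i) v)" if "i \<le> h" for i
      using \<phi>_chain[of i "\<lambda>j. \<phi> ((N ^^ (h - j)) v)"] that by (simp add: \<pi>_def)
    moreover have "(N ^^ i) (v - \<pi> v) = (N ^^ i) v - (N ^^ i) (\<pi> v)" for i
      using pow_add[of i "v - \<pi> v" "\<pi> v"] by simp
    ultimately show ?thesis
      using that \<pi>_M M subspace_diff by (simp add: M'_def f.diff)
  qed
  \<comment> \<open>Used for \<open>r = 0\<close> and \<open>r = 1\<close>. The value
    \<open>r = 1\<close> forgets the coordinate at \<open>i = 0\<close>, which is the coefficient of
    \<open>(N ^^ h) w\<close>, and thus yields the quotient by that line.\<close>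
  define F where "F r v = (vec (Suc h - r) (\<lambda>i. \<phi> ((N ^^ (i + r)) v)), v - \<pi> v)" for r v
  let ?P = "\<lambda>r. umodule_sum (jordan_module (Suc h - r)) (operator_module scale M' (\<lambda>v. v + N v))"
  have F_carrier: "F r ` M = carrier (?P r)" if "r \<le> Suc h" for r
  proof (intro equalityI subsetI)
    fix x assume "x \<in> F r ` M"
    then show "x \<in> carrier (?P r)" using compl
      by (auto simp: F_def umodule_sum_simps jordan_module_simps)
  next
    fix x assume "x \<in> carrier (?P r)"
    then obtain c v' where x: "x = (c, v')" "c \<in> carrier_vec (Suc h - r)" "v' \<in> M'"
      by (auto simp: umodule_sum_simps jordan_module_simps)
    \<comment> \<open>Coordinates run opposite to the chain; a coordinate that \<open>F r\<close>
      forgets is lifted to 0.\<close>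
    define a where "a j = (if r \<le> h - j then c $ (h - j - r) else 0)" for j
    define v where "v = (\<Sum>j\<le>h. scale (a j) ((N ^^ j) w)) + v'"
    have "v' \<in> M" using x by (simp add: M'_def)
    then have vM: "v \<in> M"
      unfolding v_def using M w pow_M by (intro subspace_add subspace_sum subspace_scale) auto
    have coord: "\<phi> ((N ^^ i) v) = a (h - i)" if "i \<le> h" for i
      using x that by (simp add: v_def pow_add f.add \<phi>_chain M'_def)
    have "\<pi> v = (\<Sum>j\<le>h. scale (a j) ((N ^^ j) w))"
      unfolding \<pi>_def by (intro sum.cong) (auto simp: coord)
    then have "v - \<pi> v = v'" by (simp add: v_def)
    moreover have "vec (Suc h - r) (\<lambda>i. \<phi> ((N ^^ (i + r)) v)) = c"
      using x(2) by (intro eq_vecI) (auto simp: coord a_def)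
    ultimately show "x \<in> F r ` M" using x(1) vM by (intro image_eqI[of _ _ v]) (auto simp: F_def)
  qed
  have F_add: "F r (x + y) = F r x \<oplus>\<^bsub>?P r\<^esub> F r y" for r x y
    by (auto simp: F_def umodule_sum_simps jordan_module_simps pow_add f.add \<pi>_add intro!: eq_vecI)
  have F_scale: "F r (scale c x) = c \<odot>\<^bsub>?P r\<^esub> F r x" for r c x
    by (auto simp: F_def umodule_sum_simps jordan_module_simps pow_scale f.scale \<pi>_scale
        scale_right_diff_distrib intro!: eq_vecI)
  have F_act: "F r (x + N x) = act (?P r) (F r x)" if "x \<in> M" for r x
  proof -
    have "\<phi> ((N ^^ (i + r)) (x + N x)) = \<phi> ((N ^^ (i + r)) x)
        + (if Suc i < Suc h - r then \<phi> ((N ^^ (Suc i + r)) x) else 0)" if "i < Suc h - r" for i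
    proof -
      have "(N ^^ (i + r)) (N x) = (N ^^ (Suc i + r)) x"
        by (simp add: funpow_swap1)
      moreover have "\<phi> ((N ^^ (Suc i + r)) x) = 0" if "\<not> Suc i < Suc h - r"
        using that \<open>i < Suc h - r\<close> \<open>x \<in> M\<close> by (intro \<phi>_van) auto
      ultimately show ?thesis by (simp add: pow_add f.add del: funpow.simps)
    qed
    then show ?thesis
      using that
      by (auto simp: F_def umodule_sum_simps jordan_module_simps jordan_block_mult_vec \<pi>_add \<pi>_N
          N.diff intro!: eq_vecI simp del: funpow.simps)
  qed
  have \<pi>_diff: "\<pi> (x - y) = \<pi> x - \<pi> y" for x y
    using \<pi>_add[of "x - y" y] by (simp add: algebra_simps)
  have pow_diff: "(N ^^ i) (x - y) = (N ^^ i) x - (N ^^ i) y" for i x y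
    using pow_add[of i "x - y" y] by (simp add: algebra_simps)
  have F_ker: "F r x = F r y \<longleftrightarrow> (\<forall>i<Suc h - r. \<phi> ((N ^^ (i + r)) (x - y)) = 0) \<and> \<pi> (x - y) = x - y"
    for r x y
    by (auto simp: F_def vec_eq_iff pow_diff f.diff \<pi>_diff algebra_simps)
  have "\<pi> v = 0" if "\<forall>i<Suc h. \<phi> ((N ^^ i) v) = 0" for v
    using that by (simp add: \<pi>_def)
  then have inj0: "inj_on (F 0) M"
    using F_ker[of 0] by (fastforce simp: inj_on_def)
  have hom0: "F 0 \<in> module_hom class_ring (operator_module scale M (\<lambda>v. v + N v)) (?P 0)"
    using F_carrier[of 0] F_add F_scale by (auto simp: module_hom_def)
  show "umodule_iso (operator_module scale M (\<lambda>v. v + N v))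
      (umodule_sum (jordan_module (Suc h)) (operator_module scale M' (\<lambda>v. v + N v)))"
    unfolding umodule_iso_def
    using hom0 inj0 F_carrier[of 0] F_act[of _ 0] by (intro bexI[of _ "F 0"]) (auto simp: bij_betw_def)
  let ?Z = "range (\<lambda>c. scale c ((N ^^ h) w))"
  have Z: "subspace ?Z"
    unfolding subspace_def by (auto simp: image_iff scale_left_distrib[symmetric] intro: exI[of _ 0])
  have ker1: "F 1 x = F 1 y \<longleftrightarrow> x - y \<in> ?Z" for x y
  proof
    assume "F 1 x = F 1 y"
    then have *: "\<forall>i<h. \<phi> ((N ^^ (i + 1)) (x - y)) = 0" "\<pi> (x - y) = x - y"
      by (simp_all add: F_ker)
    have "\<phi> ((N ^^ (h - j)) (x - y)) = 0" if "j < h" for j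
      using *(1)[rule_format, of "h - Suc j"] that by (simp add: Suc_diff_Suc del: funpow.simps)
    then have "\<pi> (x - y) = (\<Sum>j\<le>h. if j = h then scale (\<phi> (x - y)) ((N ^^ j) w) else 0)"
      unfolding \<pi>_def by (intro sum.cong) auto
    then show "x - y \<in> ?Z" using *(2) by auto
  next
    assume "x - y \<in> ?Z"
    then obtain c where c: "x - y = scale c ((N ^^ h) w)" by auto
    have "\<phi> ((N ^^ i) (x - y)) = (if i = 0 then c else 0)" for i
      using \<phi>(3)[of h] van[of "i + h"] by (auto simp: c pow_scale pow_pow f.scale f.zero)
    moreover from this have "\<pi> (x - y) = (\<Sum>j\<le>h. if j = h then scale c ((N ^^ j) w) else 0)"
      unfolding \<pi>_def by (intro sum.cong) auto
    ultimately show "F 1 x = F 1 y" by (simp add: F_ker c del: funpow.simps)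
  qed
  show "umodule_iso (umodule_quotient (operator_module scale M (\<lambda>v. v + N v)) ?Z)
      (umodule_sum (jordan_module h) (operator_module scale M' (\<lambda>v. v + N v)))"
  proof -
    have "umodule_iso (umodule_quotient (operator_module scale M (\<lambda>v. v + N v)) ?Z) (?P 1)"
    proof (rule umodule_iso_quotientI[where F = "F 1"])
      show "?Z \<subseteq> M" using M w pow_M subspace_scale by blast
      show "(\<lambda>v. v + N v) ` M \<subseteq> M" using M NM subspace_add by blast
      show "F 1 ` M = carrier (?P 1)" by (rule F_carrier) simp
    qed (rule M Z F_add F_scale ker1 | (rule F_act, assumption))+
    then show ?thesis by simp
  qed
qed

end

section \<open>The symplectic Lie algebra\<close>

locale symplectic_isometry = symplectic_space scale Basis b
  for scale :: "'k::field \<Rightarrow> 'v::ab_group_add \<Rightarrow> 'v" and Basis and b +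
  fixes u :: "'v \<Rightarrow> 'v"
  assumes u_Sp: "u \<in> Sp scale b" and char_2: "CHAR('k) = 2"
begin

lemma two_eq_0: "(2::'k) = 0"
  using of_nat_CHAR[where 'a = 'k] char_2 by simp

lemma add_self_scalar [simp]: "c + c = (0::'k)"
  using two_eq_0 by (metis mult_2 mult_zero_left)

lemma add_self [simp]: "v + v = (0::'v)"
  using scale_left_distrib[of 1 1 v] by simp

lemma add_self_left [simp]: "v + (v + w) = (w::'v)"
  by (simp add: add.assoc[symmetric])

lemma add_self_scalar_left [simp]: "c + (c + d) = (d::'k)"
  by (simp add: add.assoc[symmetric])

lemma add_eq_0_iff_eq: "v + w = 0 \<longleftrightarrow> v = (w::'v)"
  by (metis add_self add_left_cancel)

lemma add_eq_0_iff_eq_scalar: "c + d = 0 \<longleftrightarrow> c = (d::'k)"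
  by (metis add_self_scalar add_left_cancel)

lemma minus_eq_plus: "v - w = v + (w::'v)"
  by (simp add: diff_eq_eq add.assoc)

lemma b_left: "b (v + v') w = b v w + b v' w" "b (scale c v) w = c * b v w" "b 0 w = 0"
  using linear_left[of w] Vector_Spaces.linear.axioms(3)[OF linear_left[of w], THEN module_hom.zero]
  by (auto simp: Vector_Spaces.linear_iff)

lemma b_right: "b v (w + w') = b v w + b v w'" "b v (scale c w) = c * b v w" "b v 0 = 0"
  using linear_right[of v] Vector_Spaces.linear.axioms(3)[OF linear_right[of v], THEN module_hom.zero]
  by (auto simp: Vector_Spaces.linear_iff)

lemma b_sum_left: "b (sum f A) w = (\<Sum>i\<in>A. b (f i) w)"
  using Vector_Spaces.linear.axioms(3)[OF linear_left[of w], THEN module_hom.sum] .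

lemma b_sym: "b v w = b w v"
proof -
  have "b v w + b w v = 0"
    using alternating[of "v + w"] unfolding b_left b_right by (simp add: alternating add.commute)
  then show ?thesis by (simp add: add_eq_0_iff_eq_scalar)
qed

lemma nondegenerate_right: "(\<And>w. b w v = 0) \<Longrightarrow> v = 0"
  using nondegenerate[of v] by (simp add: b_sym[of v])

lemma eq_by_b: "(\<And>w. b v w = b v' w) \<Longrightarrow> v = v'"
  using nondegenerate[of "v + v'"] by (simp add: b_left add_eq_0_iff_eq)

lemma linear_u: "Vector_Spaces.linear scale scale u" and bij_u: "bij u"
  and b_u [simp]: "b (u v) (u w) = b v w"
  using u_Sp by (auto simp: Sp_def)

lemmas module_hom_u = Vector_Spaces.linear.axioms(3)[OF linear_u]
lemmas u_add = module_hom.add[OF module_hom_u]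
  and u_scale = module_hom.scale[OF module_hom_u]
  and u_0 [simp] = module_hom.zero[OF module_hom_u]
  and u_sum = module_hom.sum[OF module_hom_u]

abbreviation ui :: "'v \<Rightarrow> 'v" where "ui \<equiv> inv_into UNIV u"

lemma u_ui [simp]: "u (ui v) = v" and ui_u [simp]: "ui (u v) = v"
  using bij_u by (simp_all add: bij_is_surj bij_is_inj surj_f_inv_f)

lemma ui_add: "ui (v + w) = ui v + ui w"
  by (metis u_ui ui_u u_add)

lemma ui_scale: "ui (scale c v) = scale c (ui v)"
  by (metis u_ui ui_u u_scale)

lemma linear_ui: "Vector_Spaces.linear scale scale ui"
  using vector_space_axioms by (simp add: Vector_Spaces.linear_iff ui_add ui_scale)

lemma b_ui: "b (ui v) w = b v (u w)"
  by (metis b_u u_ui)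

lemma b_ui_right: "b v (ui w) = b (u v) w"
  by (metis b_u u_ui)

abbreviation scale_fun :: "'k \<Rightarrow> ('v \<Rightarrow> 'v) \<Rightarrow> 'v \<Rightarrow> 'v" where
  "scale_fun \<equiv> \<lambda>c X v. scale c (X v)"

lemma vector_space_fun: "vector_space scale_fun"
  by unfold_locales (auto simp: fun_eq_iff scale_left_distrib scale_right_distrib)

section \<open>The Lie algebra, conjugation by \<open>u\<close>, and the center\<close>

lemma sp_iff: "X \<in> sp scale b \<longleftrightarrow>
    Vector_Spaces.linear scale scale X \<and> (\<forall>v w. b (X v) w = b v (X w))"
  by (simp add: sp_def add_eq_0_iff_eq_scalar)

lemma subspace_sp: "module.subspace scale_fun (sp scale b)"
proof -
  interpret F: vector_space scale_fun by (rule vector_space_fun)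
  show ?thesis
    using vector_space_axioms
    by (auto simp: F.subspace_def sp_iff Vector_Spaces.linear_iff b_left b_right
        scale_right_distrib algebra_simps)
qed

definition Ad :: "('v \<Rightarrow> 'v) \<Rightarrow> 'v \<Rightarrow> 'v" where "Ad X = u \<circ> X \<circ> ui"

text \<open>This is \<open>Ad - 1\<close>, as signs do not matter in characteristic two.\<close>

definition N :: "('v \<Rightarrow> 'v) \<Rightarrow> 'v \<Rightarrow> 'v" where "N X = Ad X + X"

lemma Ad_eq: "u \<circ> X \<circ> ui = X + N X"
  by (auto simp: N_def Ad_def fun_eq_iff ac_simps)

lemma linear_N: "Vector_Spaces.linear scale_fun scale_fun N"
  using vector_space_fun
  by (simp add: Vector_Spaces.linear_iff N_def Ad_def fun_eq_iff u_add u_scale scale_right_distrib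
      ac_simps)

lemma Ad_sp:
  assumes "X \<in> sp scale b" shows "Ad X \<in> sp scale b"
proof -
  have "b (Ad X v) w = b v (Ad X w)" for v w
  proof -
    have "b (Ad X v) w = b (X (ui v)) (ui w)" by (simp add: Ad_def b_ui_right)
    also have "\<dots> = b (ui v) (X (ui w))" using assms by (simp add: sp_iff)
    also have "\<dots> = b v (Ad X w)" by (simp add: Ad_def b_ui)
    finally show ?thesis .
  qed
  moreover have "Vector_Spaces.linear scale scale (Ad X)"
    using assms linear_u linear_ui unfolding Ad_def sp_iff
    by (blast intro: Vector_Spaces.linear_compose)
  ultimately show ?thesis by (simp add: sp_iff)
qed

lemma N_sp: "N ` sp scale b \<subseteq> sp scale b"
proof -
  interpret F: vector_space scale_fun by (rule vector_space_fun)
  show ?thesis using F.subspace_add[OF subspace_sp] Ad_sp by (auto simp: N_def)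
qed

lemma N_id: "N id = 0"
  by (auto simp: N_def Ad_def fun_eq_iff)

lemma N_funpow: "(N ^^ (2 ^ a)) X = ((u ^^ (2 ^ a)) \<circ> X \<circ> (ui ^^ (2 ^ a))) + X"
proof -
  have "(N ^^ (2 ^ a)) X = (Ad ^^ (2 ^ a)) X + (id ^^ (2 ^ a)) X"
    unfolding N_def using frobenius_funpow[of Ad id a X]
    by (simp add: additive_def Ad_def fun_eq_iff u_add)
  moreover have "(Ad ^^ n) X = (u ^^ n) \<circ> X \<circ> (ui ^^ n)" for n
    by (induction n) (simp_all add: Ad_def fun_eq_iff funpow_swap1)
  ultimately show ?thesis by (simp add: id_funpow)
qed

text \<open>Commuting with the rank one operators \<open>v \<mapsto> b(v, a) a\<close> makes every
  \<open>a\<close> an eigenvector, and non-orthogonal vectors share their eigenvalue. Conversely,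
  scalars lie in the algebra because the characteristic is two.\<close>

lemma lie_center_sp:
  "lie_center (sp scale b) = range (\<lambda>c. scale_fun c id)"
proof (intro equalityI subsetI)
  fix X assume X: "X \<in> lie_center (sp scale b)"
  then have lin: "Vector_Spaces.linear scale scale X"
    and comm: "\<And>Y v. Y \<in> sp scale b \<Longrightarrow> X (Y v) = Y (X v)"
    by (auto simp: lie_center_def sp_iff)
  have tv: "(\<lambda>v. scale (b v a) a) \<in> sp scale b" for a
    using vector_space_axioms
    by (simp add: sp_iff Vector_Spaces.linear_iff b_left b_right scale_left_distrib b_sym[of a])
  have eig: "scale (b v a) (X a) = scale (b (X v) a) a" for v a
    using comm[OF tv, of v a] lin by (simp add: Vector_Spaces.linear_iff)
  have "\<exists>c. X = (\<lambda>v. scale c v)"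
  proof (cases "\<exists>a::'v. a \<noteq> 0")
    case False
    then show ?thesis by (intro exI[of _ 0] ext) metis
  next
    case True
    then obtain a v where va: "b v a \<noteq> 0" using nondegenerate_right by metis
    define c where "c = b (X v) a / b v a"
    have cancel: "x = y" if "scale d x = scale d y" "d \<noteq> 0" for d :: 'k and x y
      using that by simp
    have Xa: "X a = scale c a"
      by (rule cancel[OF _ va]) (simp add: eig c_def va)
    have nz: "b a v \<noteq> 0" using va b_sym by metis
    have Xv: "X v = scale c v"
      by (rule cancel[OF _ nz]) (simp add: eig Xa b_left mult.commute)
    have *: "X w = scale c w" if "b v w \<noteq> 0" for w
      by (rule cancel[OF _ that]) (simp add: eig Xv b_left mult.commute)
    have "X w = scale c w" for w
    proof (cases "b v w = 0")
      case True
      \<comment> \<open>A vector orthogonal to \<open>v\<close> is moved off the hyperplane by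
        adding \<open>a\<close>, whose eigenvalue is known.\<close>
      then have "X (w + a) = scale c (w + a)" using va by (intro *) (simp add: b_right)
      then show ?thesis
        using lin Xa by (simp add: Vector_Spaces.linear_iff scale_right_distrib)
    qed (use * in auto)
    then show ?thesis by blast
  qed
  then show "X \<in> range (\<lambda>c. scale_fun c id)" by (auto simp: fun_eq_iff)
next
  fix X assume "X \<in> range (\<lambda>c. scale_fun c id)"
  then show "X \<in> lie_center (sp scale b)"
    using vector_space_axioms
    by (auto simp: lie_center_def sp_iff Vector_Spaces.linear_iff b_left b_right scale_right_distrib
        mult.commute)
qed

end

section \<open>Obstructions to primitives of the identity\<close>

context symplectic_isometry
begin

section \<open>The nilpotent operator \<open>u - 1\<close> and two obstruction lemmas\<close>

definition y :: "'v \<Rightarrow> 'v" where "y v = u v + v"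

lemma y_add: "y (v + w) = y v + y w" and y_0 [simp]: "y 0 = 0"
  by (simp_all add: y_def u_add ac_simps)

lemma y_pow_0 [simp]: "(y ^^ j) 0 = 0"
  by (induction j) auto

lemma u_pow_0 [simp]: "(u ^^ j) 0 = 0"
  by (induction j) auto

lemma u_pow_add: "(u ^^ j) (v + w) = (u ^^ j) v + (u ^^ j) w"
  by (induction j) (auto simp: u_add)

lemma b_u_pow [simp]: "b ((u ^^ j) v) ((u ^^ j) w) = b v w"
  by (induction j) auto

lemma u_y: "u (y v) = y (u v)"
  by (simp add: y_def u_add)

lemma y_pow_two: "(y ^^ (2 ^ a)) v = (u ^^ (2 ^ a)) v + v"
proof -
  have "y = (\<lambda>v. u v + id v)" by (simp add: y_def fun_eq_iff)
  then show ?thesis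
    using frobenius_funpow[of u id a v] by (simp add: additive_def u_add id_funpow)
qed

lemma u_pow_pred_two: "(u ^^ (2 ^ a - 1)) v = (\<Sum>i<2 ^ a. (y ^^ i) v)"
proof -
  have "u = (\<lambda>v. y v + id v)" by (simp add: y_def fun_eq_iff add.assoc)
  then show ?thesis
    using frobenius_funpow_pred[of y id a v] by (simp add: additive_def y_add id_funpow)
qed

lemma of_nat_odd: "odd n \<Longrightarrow> of_nat n = (1::'k)"
  by (auto elim!: oddE simp: two_eq_0)

text \<open>Telescoping sum over two dual bases, on which \<open>g\<close> acts by mutually inverse unipotent matrices.\<close>

lemma no_primitive_dual_bases:
  assumes B: "\<And>v v' w. B (v + v') w = B v w + B v' w" "\<And>v w w'. B v (w + w') = B v w + (B v w' :: 'k)"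
    and Bg: "\<And>v w. B (g v) (g w) = B v w + b v w"
    and a: "\<And>i. g (a i) = a i + a (Suc i)" "a r = 0"
    and a': "g (a' 0) = a' 0" "\<And>i. Suc i < r \<Longrightarrow> g (a' (Suc i) + a' i) = a' (Suc i)"
    and dual: "\<And>i. i < r \<Longrightarrow> b (a i) (a' i) = 1"
    and g: "\<And>v w. g (v + w) = g v + g w"
  shows "even r"
proof (rule ccontr)
  assume "odd r"
  then obtain r' where r: "r = Suc r'" by (cases r) auto
  have B0: "B 0 w = 0" for w using B(1)[of 0 0 w] by simp
  \<comment> \<open>Expanding by the action of \<open>g\<close> on the two families shows that the
    sum of \<open>B\<close> over the dual pairs is unchanged by \<open>g\<close>; by
    \<open>Bg\<close> it also changes by \<open>r\<close>, so \<open>r\<close> vanishes in the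
    field.\<close>
  have "(\<Sum>i<r. B (g (a i)) (g (a' i))) = (\<Sum>i<r. B (a i) (g (a' i))) + (\<Sum>i<r. B (a (Suc i)) (g (a' i)))"
    by (simp add: a(1) B sum.distrib)
  also have "(\<Sum>i<r. B (a i) (g (a' i))) = B (a 0) (a' 0) + (\<Sum>i<r'. B (a (Suc i)) (g (a' (Suc i))))"
    by (simp add: r sum.lessThan_Suc_shift a'(1) del: sum.lessThan_Suc)
  also have "(\<Sum>i<r. B (a (Suc i)) (g (a' i))) = (\<Sum>i<r'. B (a (Suc i)) (g (a' i)))"
    using a(2) by (simp add: r B0)
  also have "B (a 0) (a' 0) + (\<Sum>i<r'. B (a (Suc i)) (g (a' (Suc i)))) + (\<Sum>i<r'. B (a (Suc i)) (g (a' i)))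
      = B (a 0) (a' 0) + (\<Sum>i<r'. B (a (Suc i)) (a' (Suc i)))"
  proof -
    have "B (a (Suc i)) (g (a' (Suc i))) + B (a (Suc i)) (g (a' i)) = B (a (Suc i)) (a' (Suc i))"
      if "i < r'" for i
      using a'(2)[of i] that by (simp add: r B(2)[symmetric] g[symmetric])
    then show ?thesis by (simp add: add.assoc sum.distrib[symmetric])
  qed
  also have "\<dots> = (\<Sum>i<r. B (a i) (a' i))"
    by (simp add: r sum.lessThan_Suc_shift del: sum.lessThan_Suc)
  finally have "(\<Sum>i<r. B (a i) (a' i)) + (\<Sum>i<r. b (a i) (a' i)) = (\<Sum>i<r. B (a i) (a' i))"
    by (simp add: Bg sum.distrib)
  then have "(of_nat r :: 'k) = 0" using dual by simp
  with \<open>odd r\<close> show False by (simp add: of_nat_odd)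
qed

text \<open>
  With \<open>h = g + g\<inverse>\<close>, which is self-adjoint for \<open>b\<close>, one has \<open>B(v, h w) = (B + b)(h v, w)\<close>; apply this to
  \<open>h\<^sup>2\<^sup>e\<^sup>+\<^sup>1 x = 0\<close>.
\<close>

lemma no_primitive_cyclic:
  assumes B: "\<And>v v' w. B (v + v') w = B v w + B v' w" "\<And>v w w'. B v (w + w') = B v w + (B v w' :: 'k)"
    and Bsym: "\<And>v w. B v w = B w v"
    and Bg: "\<And>v w. B (g v) (g w) = B v w + b v w"
    and bg: "\<And>v w. b (g v) (g w) = b v w"
    and g': "\<And>v. g (g' v) = v" "\<And>v. g' (g v) = v"
    and add: "\<And>v w. g (v + w) = g v + g w" "\<And>v w. g' (v + w) = g' v + g' w"
    and x: "((\<lambda>v. g v + v) ^^ (2 * (2 * e + 1))) x = 0"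
  defines "w \<equiv> ((\<lambda>v. g v + v) ^^ (2 * e)) x"
  shows "b (g w) w = 0"
proof -
  define h where "h v = g v + g' v" for v
  define n where "n v = g v + v" for v
  \<comment> \<open>The identity \<open>g + g\<inverse> = g\<inverse> (g + 1)\<^sup>2\<close>
    translates the nilpotency of \<open>g + 1\<close> into that of \<open>h\<close>.\<close>
  have h_n: "h v = g' (n (n v))" for v
    by (simp add: h_def n_def add g' ac_simps)
  have comm: "n (g' v) = g' (n v)" for v
    by (simp add: n_def add g' ac_simps)
  have comm_pow: "n (n ((g' ^^ j) v)) = (g' ^^ j) (n (n v))" for j v
    by (induction j) (simp_all add: comm)
  have h_pow: "(h ^^ j) v = (g' ^^ j) ((n ^^ (2 * j)) v)" for j v
    by (induction j) (simp_all add: h_n comm_pow)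
  have g'0: "g' 0 = 0" using add(2)[of 0 0] by simp
  have g'_pow_0: "(g' ^^ j) 0 = 0" for j
    by (induction j) (simp_all add: g'0)
  have hx: "(h ^^ (2 * e + 1)) x = 0"
    unfolding h_pow using x by (simp only: n_def[abs_def] g'_pow_0)
  have b': "b v (g' w) = b (g v) w" for v w
    using bg[of v "g' w"] by (simp add: g')
  have B': "B v (g' w) = B (g v) w + b (g v) w" for v w
    using Bg[of v "g' w"] b'[of v w] by (simp add: g' add.assoc)
  have bh: "b (h v) w = b v (h w)" for v w
    using b' b_sym by (simp add: h_def b_left b_right add.commute)
  have Bh: "B v (h w) = B (h v) w + b (h v) w" for v w
  proof -
    have "B (g' v) w = B v (g w) + b v (g w)"
      using B'[of w v] Bsym b_sym by metis
    moreover have "b (g' v) w = b v (g w)" using b' b_sym by metis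
    ultimately show ?thesis
      by (simp add: h_def B B' b_left add.assoc two_eq_0)
  qed
  have bj: "b v ((h ^^ j) z) = b ((h ^^ j) v) z" for j v z
    by (induction j arbitrary: v z) (simp_all add: bh[symmetric] funpow_swap1)
  have Bh_pow: "B v ((h ^^ j) w) = B ((h ^^ j) v) w + of_nat j * b ((h ^^ j) v) w" for j v w
  proof (induction j arbitrary: v)
    case (Suc j)
    have "B v ((h ^^ Suc j) w) = B (h v) ((h ^^ j) w) + b ((h ^^ j) (h v)) w"
      by (simp add: Bh bj)
    also have "\<dots> = B ((h ^^ j) (h v)) w + of_nat (Suc j) * b ((h ^^ j) (h v)) w"
      using Suc[of "h v"] by (simp add: algebra_simps)
    also have "(h ^^ j) (h v) = (h ^^ Suc j) v" by (simp add: funpow_swap1)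
    finally show ?case .
  qed simp
  \<comment> \<open>The middle of the odd power: moving \<open>e\<close> factors of \<open>h\<close>
    to the left in \<open>B(x, h\<^sup>2\<^sup>e\<^sup>+\<^sup>1 x)\<close> leaves
    \<open>B(z, h z)\<close> and a multiple of \<open>b(z, h z)\<close>.\<close>
  define z where "z = (h ^^ e) x"
  have bz: "b z (h z) = 0"
    by (simp add: h_def b_right b' b_sym[of "g z"])
  have "(h ^^ e) ((h ^^ (e + 1)) x) = 0"
    using hx fun_cong[OF funpow_add[of e "e + 1" h], of x] by (simp add: mult_2 add.assoc)
  then have "B x 0 = B z (h z) + of_nat e * b z (h z)"
    using Bh_pow[of x e "(h ^^ (e + 1)) x"] by (simp add: z_def)
  moreover have "B x 0 = 0" using B(2)[of x 0 0] by simp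
  ultimately have "B z (h z) = 0" by (simp add: bz)
  \<comment> \<open>By \<open>B'\<close> and symmetry, \<open>B(z, h z)\<close> is
    \<open>B(z, g z) + B(g z, z) + b(g z, z)\<close>, where the first two terms cancel.\<close>
  then have "b (g z) z = 0"
    using Bsym[of z "g z"] by (simp add: h_def B B' add.assoc)
  moreover have "z = (g' ^^ e) w"
    by (simp add: z_def h_pow w_def n_def[abs_def])
  moreover have "b (g ((g' ^^ j) v)) ((g' ^^ j) v) = b (g v) v" for j v
  proof (induction j)
    case (Suc j)
    have "b (g (g' ((g' ^^ j) v))) (g' ((g' ^^ j) v)) = b (g ((g' ^^ j) v)) ((g' ^^ j) v)"
      by (simp add: b' g')
    then show ?case using Suc by simp
  qed simp
  ultimately show ?thesis by simp
qed

end

section \<open>Bases adapted to the orthogonal decomposition\<close>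

text \<open>
  Each index \<open>i\<close> stands for a summand \<open>W(m i)\<close>, if \<open>i \<in> W\<close>, or else \<open>V(2 * m i)\<close>, with basis
  \<open>x i 1, \<dots>, x i (2 * m i)\<close>; the junk value \<open>x i 0 = 0\<close> lets the formulas for \<open>u\<close> start at \<open>0\<close>.
\<close>

locale symplectic_blocks = symplectic_isometry scale Basis b u
  for scale :: "'k::field \<Rightarrow> 'v::ab_group_add \<Rightarrow> 'v" and Basis and b and u +
  fixes I W :: "'i set" and m :: "'i \<Rightarrow> nat" and x :: "'i \<Rightarrow> nat \<Rightarrow> 'v" and q \<alpha> :: nat
  assumes finite_I: "finite I" and q_def: "q = 2 ^ \<alpha>"
    and m_pos: "i \<in> I \<Longrightarrow> 0 < m i" and q_dvd: "i \<in> I \<Longrightarrow> q dvd m i"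
    and b_x: "\<lbrakk>i \<in> I; j \<in> I; c \<in> {1..2 * m i}; d \<in> {1..2 * m j}\<rbrakk> \<Longrightarrow>
      b (x i c) (x j d) = (if i = j \<and> c + d = 2 * m i + 1 then 1 else 0)"
    and span_x: "span (\<Union>i\<in>I. x i ` {1..2 * m i}) = UNIV"
    and x_0 [simp]: "x i 0 = 0"
    and u_low: "\<lbrakk>i \<in> I; c \<le> m i\<rbrakk> \<Longrightarrow> u (x i c) = (\<Sum>d=1..c. x i d)"
    and u_high: "\<lbrakk>i \<in> I; m i + 1 < c; c \<le> 2 * m i\<rbrakk> \<Longrightarrow> u (x i c) = x i c + x i (c - 1)"
    and u_mid: "i \<in> I \<Longrightarrow>
      u (x i (m i + 1)) = x i (m i + 1) + (if i \<in> W then 0 else u (x i (m i)))"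
begin

lemma q_pos [simp]: "0 < q"
  by (simp add: q_def)

lemma y_low: "\<lbrakk>i \<in> I; c \<le> m i\<rbrakk> \<Longrightarrow> y (x i c) = u (x i (c - 1))"
  by (cases c) (simp_all add: y_def u_low ac_simps)

lemma u_pow_y: "(u ^^ j) (y v) = y ((u ^^ j) v)"
  by (induction j) (auto simp: u_y)

text \<open>On the lower half \<open>y\<close> is \<open>u\<close> after lowering the index.
  Truncated subtraction together with \<open>x i 0 = 0\<close> covers the powers that run past the
  bottom.\<close>

lemma y_pow_low: "\<lbrakk>i \<in> I; c \<le> m i\<rbrakk> \<Longrightarrow> (y ^^ j) (x i c) = (u ^^ j) (x i (c - j))"
  by (induction j) (simp_all add: y_low u_pow_y[symmetric] funpow_swap1)

section \<open>The chain of the last basis vector, and the span of the lower halves\<close>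

definition w :: "'i \<Rightarrow> nat \<Rightarrow> 'v" where "w i j = (y ^^ j) (x i (2 * m i))"

lemma y_w: "(y ^^ l) (w i j) = w i (l + j)"
  by (simp add: w_def funpow_add)

lemma w_top: "\<lbrakk>i \<in> I; j < m i\<rbrakk> \<Longrightarrow> w i j = x i (2 * m i - j)"
proof (induction j)
  case (Suc j)
  have "u (x i (2 * m i - j)) = x i (2 * m i - j) + x i (2 * m i - j - 1)"
    using Suc.prems by (intro u_high) auto
  then show ?case using Suc by (simp add: w_def y_def add.commute)
qed (simp add: w_def)

text \<open>Here the two kinds of summand part: the chain dies on \<open>W(m)\<close> and enters the
  lower half on \<open>V(2m)\<close>.\<close>

lemma w_m: "i \<in> I \<Longrightarrow> w i (m i) = (if i \<in> W then 0 else u (x i (m i)))"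
  using w_top[of i "m i - 1"] m_pos[of i] y_w[of 1 i "m i - 1"] u_mid[of i]
  by (auto simp: y_def add.commute mult_2)

lemma y_pow_u: "(y ^^ j) (u v) = u ((y ^^ j) v)"
  by (induction j) (simp_all add: u_y)

lemma w_low_V: "\<lbrakk>i \<in> I; i \<notin> W\<rbrakk> \<Longrightarrow> w i (m i + j) = (u ^^ Suc j) (x i (m i - j))"
  using w_m[of i] y_w[of j i "m i"] y_pow_low[of i "m i" j]
  by (simp add: add.commute y_pow_u)

text \<open>A \<open>u\<close>-stable Lagrangian subspace, in duality with the span of the upper
  halves.\<close>

definition A :: "'v set" where "A = span (\<Union>i\<in>I. x i ` {1..m i})"

lemma subspace_A: "subspace A"
  by (simp add: A_def)

lemma x_A: "\<lbrakk>i \<in> I; c \<le> m i\<rbrakk> \<Longrightarrow> x i c \<in> A"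
  unfolding A_def by (cases "c = 0") (auto intro!: span_base span_zero bexI[of _ i])

lemma A_induct: "\<lbrakk>subspace S; \<And>i c. \<lbrakk>i \<in> I; c \<in> {1..m i}\<rbrakk> \<Longrightarrow> x i c \<in> S\<rbrakk> \<Longrightarrow> A \<subseteq> S"
  unfolding A_def by (intro span_minimal) auto

lemma all_induct: "\<lbrakk>subspace S; \<And>i c. \<lbrakk>i \<in> I; c \<in> {1..2 * m i}\<rbrakk> \<Longrightarrow> x i c \<in> S\<rbrakk> \<Longrightarrow> v \<in> S"
  using span_minimal[of "\<Union>i\<in>I. x i ` {1..2 * m i}" S] unfolding span_x by blast

lemma u_A: "v \<in> A \<Longrightarrow> u v \<in> A"
proof -
  have "A \<subseteq> {v. u v \<in> A}"
  proof (rule A_induct)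
    show "subspace {v. u v \<in> A}"
      using subspace_A by (auto simp: subspace_def u_add u_scale)
    show "x i c \<in> {v. u v \<in> A}" if "i \<in> I" "c \<in> {1..m i}" for i c
      using that by (auto simp: u_low intro!: subspace_sum[OF subspace_A] x_A)
  qed
  then show "v \<in> A \<Longrightarrow> u v \<in> A" by auto
qed

lemma u_pow_A: "v \<in> A \<Longrightarrow> (u ^^ j) v \<in> A"
  by (induction j) (auto simp: u_A)

lemma y_A: "v \<in> A \<Longrightarrow> y v \<in> A"
  by (simp add: y_def u_A subspace_add[OF subspace_A])

lemma y_pow_A: "v \<in> A \<Longrightarrow> (y ^^ j) v \<in> A"
  by (induction j) (auto simp: y_A)

lemma isotropic_A: "\<lbrakk>v \<in> A; v' \<in> A\<rbrakk> \<Longrightarrow> b v v' = 0"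
proof -
  have *: "A \<subseteq> {v. b v (x i c) = 0}" if "i \<in> I" "c \<in> {1..m i}" for i c
    using that by (intro A_induct) (auto simp: subspace_def b_left b_x)
  have "A \<subseteq> {v'. b v v' = 0}" if "v \<in> A"
    using that * by (intro A_induct) (auto simp: subspace_def b_right)
  then show "\<lbrakk>v \<in> A; v' \<in> A\<rbrakk> \<Longrightarrow> b v v' = 0" by auto
qed

lemma w_A:
  assumes "i \<in> I" "m i \<le> j"
  shows "w i j \<in> A"
proof -
  have "w i (m i) \<in> A"
    using assms by (simp add: w_m x_A u_A subspace_0[OF subspace_A])
  then show ?thesis
    using assms y_pow_A[of "w i (m i)" "j - m i"] y_w[of "j - m i" i "m i"] by simp
qed

text \<open>Pairings with the lower halves vanish on both sides, since \<open>A\<close> is totally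
  isotropic.\<close>

lemma eq_if_eq_on_top:
  assumes "v \<in> A" "v' \<in> A"
    and "\<And>i c. \<lbrakk>i \<in> I; c \<in> {m i + 1..2 * m i}\<rbrakk> \<Longrightarrow> b v (x i c) = b v' (x i c)"
  shows "v = v'"
proof (rule eq_by_b)
  fix z
  have "z \<in> {z. b v z = b v' z}"
  proof (rule all_induct)
    show "subspace {z. b v z = b v' z}" by (auto simp: subspace_def b_right)
    show "x i c \<in> {z. b v z = b v' z}" if "i \<in> I" "c \<in> {1..2 * m i}" for i c
    proof (cases "c \<le> m i")
      case True
      then have "x i c \<in> A" using that x_A by auto
      then show ?thesis using assms isotropic_A by simp
    qed (use that assms(3) in auto)
  qed
  then show "b v z = b v' z" by simp
qed

text \<open>Invariance of \<open>b\<close> under \<open>u\<close> becomes Pascal's rule for these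
  pairings, because \<open>y\<close> raises the chain index and lowers the basis index by
  one.\<close>

lemma b_w_low:
  assumes i: "i \<in> I" "i \<notin> W" and s: "s < m i"
  shows "b (w i (m i + a)) (x i (m i + 1 + s)) = of_nat (s choose a)"
  using s
proof (induction a arbitrary: s)
  case 0
  have "b (w i (m i)) (x i (m i + 1 + s)) = (\<Sum>c=1..m i. b (x i c) (x i (m i + 1 + s)))"
    using i by (simp add: w_m u_low b_sum_left)
  also have "\<dots> = (\<Sum>c=1..m i. if c = m i - s then 1 else 0)"
    using i 0 by (intro sum.cong) (auto simp: b_x)
  finally show ?case using 0 by simp
next
  case (Suc a)
  note IH = Suc.IH
  have rel: "b (y v) (y z) + b (y v) z + b v (y z) = 0" for v z
    by (simp add: y_def b_left b_right ac_simps)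
  have yw: "y (w i (m i + a)) = w i (m i + Suc a)"
    using y_w[of 1 i "m i + a"] by simp
  show ?case
    using Suc.prems
  proof (induction s)
    case 0
    \<comment> \<open>Three vectors of \<open>A\<close> make the outer terms of \<open>rel\<close>
      vanish, so the pairing at \<open>s = 0\<close> is zero.\<close>
    have "y (x i (m i + 1)) \<in> A"
      using i u_mid[of i] u_A[OF x_A[of i "m i"]] by (simp add: y_def ac_simps)
    moreover have "w i (m i + a) \<in> A" "w i (m i + Suc a) \<in> A"
      using i by (auto intro: w_A)
    ultimately show ?case
      using rel[of "w i (m i + a)" "x i (m i + 1)"] yw isotropic_A by simp
  next
    case (Suc s)
    have "y (x i (m i + 1 + Suc s)) = x i (m i + 1 + s)"
      using i Suc.prems u_high[of i "m i + 1 + Suc s"] by (simp add: y_def add.commute)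
    then have "b (w i (m i + Suc a)) (x i (m i + 1 + Suc s))
        + (b (w i (m i + Suc a)) (x i (m i + 1 + s)) + b (w i (m i + a)) (x i (m i + 1 + s))) = 0"
      using rel[of "w i (m i + a)" "x i (m i + 1 + Suc s)"] unfolding yw by (simp only: ac_simps)
    then have "b (w i (m i + Suc a)) (x i (m i + 1 + Suc s))
        = b (w i (m i + Suc a)) (x i (m i + 1 + s)) + b (w i (m i + a)) (x i (m i + 1 + s))"
      by (simp only: add_eq_0_iff_eq_scalar)
    also have "\<dots> = of_nat (s choose Suc a) + of_nat (s choose a)"
      using Suc.IH Suc.prems IH[of s] by simp
    finally show ?case by (simp add: add.commute)
  qed
qed

end

context symplectic_isometry
begin

lemma u_ui_pow: "(u ^^ n) ((ui ^^ n) v) = v" and ui_u_pow: "(ui ^^ n) ((u ^^ n) v) = v"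
  by (induction n arbitrary: v) (simp_all add: funpow_swap1)

lemma ui_pow_add: "(ui ^^ n) (v + z) = (ui ^^ n) v + (ui ^^ n) z"
  by (induction n) (simp_all add: ui_add)

end

section \<open>The obstruction on a single summand\<close>

context symplectic_blocks
begin

text \<open>A preimage \<open>X\<close> gives the form \<open>B\<close> required by the obstruction
  lemmas, with \<open>g = u ^^ q\<close>. On \<open>W(m)\<close> the number \<open>r\<close> is the
  length of the dual bases; on \<open>V(2m)\<close> the operator \<open>g + 1\<close> kills the last
  basis vector at exponent \<open>2 * r\<close>.\<close>

lemma id_notin_N_pow:
  assumes i: "i \<in> I" and r: "m i = q * r" "odd r"
  shows "id \<notin> (N ^^ q) ` sp scale b"
proof
  assume "id \<in> (N ^^ q) ` sp scale b"
  then obtain X where X: "X \<in> sp scale b" and id: "(N ^^ q) X = id" by auto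
  have g_y: "(u ^^ q) v + v = (y ^^ q) v" for v
    by (simp add: q_def y_pow_two)
  define g where "g = u ^^ q"
  define B where "B v z = b (X v) z" for v z
  have lin: "X (v + z) = X v + X z" for v z
    using X by (simp add: sp_iff Vector_Spaces.linear_iff)
  have gX: "X (g v) = g (X v) + g v" for v
  proof -
    have "g (X v) + X (g v) = g v"
      using fun_cong[OF id, of "g v"] N_funpow[of \<alpha> X]
      by (simp add: q_def g_def ui_u_pow)
    then have "g (X v) + (g (X v) + X (g v)) = g (X v) + g v" by simp
    then show ?thesis by simp
  qed
  have Bg: "B (g v) (g z) = B v z + b v z" for v z
    by (simp add: B_def gX b_left) (simp add: g_def)
  have B: "B (v + v') z = B v z + B v' z" "B v (z + z') = B v z + B v z'" for v v' z z'
    by (simp_all add: B_def lin b_left b_right)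
  have "q \<le> m i" using r by (cases r) auto
  show False
  proof (cases "i \<in> W")
    case True
    \<comment> \<open>The operator \<open>g + 1\<close> is \<open>y ^^ q\<close>. It advances the
      chain by \<open>q\<close>, and on the lower half it is \<open>g\<close> after lowering the
      index by \<open>q\<close>; this is the inverse action needed on the dual vectors.\<close>
    have ga: "g (w i (q * t)) = w i (q * t) + w i (q * Suc t)" for t
      using g_y[of "w i (q * t)"] y_w[of q i "q * t"]
      by (metis g_def add_self_left add.commute mult_Suc_right)
    have ga': "g (x i (q * Suc t + 1) + x i (q * t + 1)) = x i (q * Suc t + 1)" if "Suc t < r" for t
    proof -
      have "q * Suc t + q \<le> m i"
        using that r(1) mult_le_mono2[of "Suc (Suc t)" r q] by simp
      then have "(y ^^ q) (x i (q * Suc t + 1)) = g (x i (q * t + 1))"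
        using y_pow_low[of i "q * Suc t + 1" q] i q_pos by (simp add: g_def)
      then show ?thesis
        using g_y[of "x i (q * Suc t + 1)"] unfolding g_def
        by (metis u_pow_add add_self_left add.commute)
    qed
    have g0: "g (x i (q * 0 + 1)) = x i (q * 0 + 1)"
      using y_pow_low[of i 1 q] i m_pos[of i] g_y[of "x i 1"] q_pos
      by (simp add: g_def add_eq_0_iff_eq)
    have dual: "b (w i (q * t)) (x i (q * t + 1)) = 1" if "t < r" for t
    proof -
      have "q * t + q \<le> m i"
        using that r(1) mult_le_mono2[of "Suc t" r q] by simp
      then have "q * t < m i" using q_pos by linarith
      then show ?thesis using i by (simp add: w_top b_x)
    qed
    have "even r"
      by (rule no_primitive_dual_bases[of B g "\<lambda>t. w i (q * t)" r "\<lambda>t. x i (q * t + 1)"])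
         (use B Bg ga ga' g0 dual True w_m[OF i] r in \<open>simp_all add: g_def u_pow_add\<close>)
    with r show False by simp
  next
    case False
    obtain e where e: "r = 2 * e + 1" using r(2) by (auto elim: oddE)
    have "(\<lambda>v. g v + v) = y ^^ q" by (simp add: g_y g_def fun_eq_iff)
    then have n_pow: "((\<lambda>v. g v + v) ^^ j) (x i (2 * m i)) = w i (q * j)" for j
      by (simp add: funpow_mult w_def mult.commute)
    have nil: "w i (q * (2 * (2 * e + 1))) = 0"
    proof -
      \<comment> \<open>The exponent is \<open>2 * m i\<close>, where \<open>w_low_V\<close> reaches
        \<open>x i 0 = 0\<close>.\<close>
      have "q * (2 * (2 * e + 1)) = m i + m i" using r(1) e by simp
      then show ?thesis
        using w_low_V[of i "m i"] i False by (simp only: x_0 u_pow_0 diff_self_eq_0 simp_thms)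
    qed
    define z where "z = w i (q * (2 * e))"
    have bz: "b (g z) z = 0"
      unfolding z_def n_pow[symmetric]
    proof (rule no_primitive_cyclic[of B g "ui ^^ q"])
      show "B v z = B z v" for v z
        using X b_sym by (metis B_def sp_iff)
      show "((\<lambda>v. g v + v) ^^ (2 * (2 * e + 1))) (x i (2 * m i)) = 0"
        by (simp only: n_pow nil)
    qed (use B Bg in \<open>simp_all add: g_def u_ui_pow ui_u_pow u_pow_add ui_pow_add\<close>)
    have gz: "g z = z + w i (m i)"
      using g_y[of z] y_w[of q i "q * (2 * e)"] r(1) e
      by (simp add: z_def g_def) (metis add_self_left add.commute)
    have z: "z = x i (m i + 1 + (q - 1))"
    proof -
      have "q * (2 * e) < m i" "2 * m i - q * (2 * e) = m i + q"
        using r(1) e q_pos by (simp_all add: distrib_left)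
      then show ?thesis using i by (simp add: z_def w_top)
    qed
    \<comment> \<open>By \<open>gz\<close> this is \<open>b(g z, z)\<close>, which was just shown to
      vanish.\<close>
    have "b (w i (m i)) z = 1"
    proof -
      have "q - 1 < m i" using \<open>q \<le> m i\<close> q_pos by linarith
      from b_w_low[OF i False this, of 0] show ?thesis
        by (simp only: z add_0_right binomial_n_0 of_nat_1)
    qed
    with bz show False by (simp only: gz b_left alternating add_0_left one_neq_zero)
  qed
qed

end

section \<open>The adjoint projection\<close>

text \<open>Neighbouring entries of this row of Pascal's triangle sum to an entry of row
  \<open>2 ^ \<alpha> * t\<close>, which is even: its product with \<open>Suc a\<close> is divisible
  by \<open>2 ^ \<alpha>\<close>, while \<open>Suc a\<close> is not.\<close>

lemma odd_choose_pred_mult_power_two: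
  assumes "a < 2 ^ \<alpha>" "0 < t"
  shows "odd ((2 ^ \<alpha> * t - 1) choose a)"
  using assms(1)
proof (induction a)
  case (Suc a)
  obtain n where n: "2 ^ \<alpha> * t = Suc n" using assms(2) by (cases "2 ^ \<alpha> * t") auto
  have "even (Suc n choose Suc a)"
  proof (rule ccontr)
    assume "odd (Suc n choose Suc a)"
    then have cop: "coprime (2 ^ \<alpha>) (Suc n choose Suc a)"
      by (simp only: coprime_power_left_iff coprime_left_2_iff_odd simp_thms)
    have "2 ^ \<alpha> dvd Suc n" by (simp only: n[symmetric] dvd_triv_left)
    then have "2 ^ \<alpha> dvd (Suc n choose Suc a) * Suc a"
      by (simp only: Suc_times_binomial_eq[symmetric] dvd_mult2)
    then have "2 ^ \<alpha> dvd Suc a" by (simp only: coprime_dvd_mult_right_iff[OF cop])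
    with Suc.prems show False by (auto dest: dvd_imp_le)
  qed
  moreover have "2 ^ \<alpha> * t - 1 = n" using n by simp
  ultimately show ?case using Suc by simp
qed simp

context symplectic_blocks
begin

text \<open>
  The values of \<open>X\<close> on the basis: on the upper half \<open>w i j \<mapsto> w i (q * (j div q))\<close>, i.e. the
  projection onto the \<open>u\<^sup>q\<close>-module generated by the last basis vector along its translates by
  \<open>u, \<dots>, u\<^sup>q\<^sup>-\<^sup>1\<close>; on the lower half the adjoint of this projection.
\<close>

definition \<xi> :: "'i \<Rightarrow> nat \<Rightarrow> 'v" where
  "\<xi> i c = (if c \<le> m i then if q dvd c - 1 then \<Sum>d<q. x i (c + d) else 0
     else x i (2 * m i - q * ((2 * m i - c) div q)))"

text \<open>The linear extension of \<open>\<xi>\<close>: the coordinate at \<open>x i c\<close> is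
  the pairing with the dual vector of index \<open>2 * m i + 1 - c\<close>.\<close>

definition X :: "'v \<Rightarrow> 'v" where
  "X v = (\<Sum>i\<in>I. \<Sum>c=1..2 * m i. scale (b v (x i (2 * m i + 1 - c))) (\<xi> i c))"

lemma X_add: "X (v + z) = X v + X z" and X_scale: "X (scale a v) = scale a (X v)"
  by (simp_all add: X_def b_left scale_left_distrib sum.distrib scale_sum_right)

lemma X_0: "X 0 = 0"
  using X_add[of 0 0] by simp

lemma X_x:
  assumes "i \<in> I" "c \<in> {1..2 * m i}"
  shows "X (x i c) = \<xi> i c"
proof -
  have "X (x i c) = (\<Sum>j\<in>I. \<Sum>d=1..2 * m j. if i = j \<and> c = d then \<xi> i c else 0)"
    unfolding X_def
  proof (intro sum.cong refl)
    fix j d assume "j \<in> I" "d \<in> {1..2 * m j}"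
    then show "scale (b (x i c) (x j (2 * m j + 1 - d))) (\<xi> j d)
        = (if i = j \<and> c = d then \<xi> i c else 0)"
      using assms by (subst b_x) auto
  qed
  also have "\<dots> = (\<Sum>j\<in>I. if i = j then \<xi> i c else 0)"
    using assms by (intro sum.cong refl) auto
  also have "\<dots> = \<xi> i c" using assms finite_I by simp
  finally show ?thesis .
qed

text \<open>A block of length \<open>q\<close> starting at a multiple of \<open>q\<close> never
  straddles another multiple; this keeps the sums in \<open>\<xi>\<close> inside the lower
  half.\<close>

lemma add_lt_of_dvd:
  assumes "q dvd n" "q dvd c" "c < n" "d < q"
  shows "c + d < n"
proof -
  obtain k k' where k: "n = q * k" "c = q * k'" using assms by (auto elim!: dvdE)
  then have "Suc k' \<le> k" using assms by (simp add: Suc_le_eq)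
  then have "q * Suc k' \<le> n" using k by (simp only: mult_le_mono2)
  then show ?thesis using k assms by simp
qed

lemma \<xi>_A: "\<lbrakk>i \<in> I; c \<in> {1..m i}\<rbrakk> \<Longrightarrow> \<xi> i c \<in> A"
  using add_lt_of_dvd[of "m i" "c - 1"] q_dvd
  by (auto simp: \<xi>_def subspace_0[OF subspace_A] less_eq_Suc_le intro!: subspace_sum[OF subspace_A] x_A)

lemma X_A: "v \<in> A \<Longrightarrow> X v \<in> A"
proof -
  have "A \<subseteq> {v. X v \<in> A}"
  proof (rule A_induct)
    show "subspace {v. X v \<in> A}"
      using subspace_A by (auto simp: subspace_def X_add X_scale X_0)
  qed (auto simp: X_x \<xi>_A)
  then show "v \<in> A \<Longrightarrow> X v \<in> A" by auto
qed

text \<open>Both sides are 1 exactly when \<open>c - 1\<close> is the start of the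
  \<open>q\<close>-block that contains \<open>2 * m i - d\<close>.\<close>

lemma b_\<xi>:
  assumes i: "i \<in> I" and c: "c \<in> {1..m i}" and d: "d \<in> {m i + 1..2 * m i}"
  shows "b (\<xi> i c) (x i d) = b (x i c) (\<xi> i d)"
proof -
  define D where "D = 2 * m i - d"
  have D: "d = 2 * m i - D" "D < m i" using d by (auto simp: D_def)
  have "b (x i c) (\<xi> i d) = (if c - 1 = q * (D div q) then 1 else 0)"
  proof -
    define E where "E = q * (D div q)"
    have "E \<le> D" by (simp add: E_def)
    then have "b (x i c) (x i (2 * m i - E)) = (if c - 1 = E then 1 else 0)"
      using i c D by (subst b_x) auto
    then show ?thesis using d by (simp add: \<xi>_def E_def D_def)
  qed
  moreover have "b (\<xi> i c) (x i d) = (if c - 1 = q * (D div q) then 1 else 0)"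
  proof (cases "q dvd c - 1")
    case True
    have "b (\<xi> i c) (x i d) = (\<Sum>e<q. if c - 1 + e = D then 1 else 0)"
    proof -
      have "b (x i (c + e)) (x i d) = (if c - 1 + e = D then 1 else 0)" if "e < q" for e
      proof -
        have "c + e \<le> m i"
        proof -
          have "c - 1 + e < m i"
            using True c that q_dvd[OF i] by (intro add_lt_of_dvd) auto
          then show ?thesis using c by simp
        qed
        then show ?thesis using i c d D by (subst b_x) auto
      qed
      then show ?thesis using True c by (simp add: \<xi>_def b_sum_left)
    qed
    also have "\<dots> = (\<Sum>e<q. if e = D mod q \<and> c - 1 = q * (D div q) then 1 else 0)"
    proof (intro sum.cong refl if_cong)
      fix e assume "e \<in> {..<q}"
      obtain k where k: "c - 1 = q * k" using True by auto
      show "(c - 1 + e = D) = (e = D mod q \<and> c - 1 = q * (D div q))"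
        using \<open>e \<in> {..<q}\<close> unfolding k by auto
    qed
    also have "\<dots> = (if c - 1 = q * (D div q) then 1 else 0)"
      by auto
    finally show ?thesis .
  next
    case False
    then show ?thesis using c by (auto simp: \<xi>_def b_left)
  qed
  ultimately show ?thesis by simp
qed

lemma \<xi>_top:
  assumes "i \<in> I" "c \<in> {m i + 1..2 * m i}"
  obtains d where "\<xi> i c = x i d" "d \<in> {m i + 1..2 * m i}"
proof -
  define E where "E = q * ((2 * m i - c) div q)"
  have "E \<le> 2 * m i - c" by (simp add: E_def)
  then have "2 * m i - E \<in> {m i + 1..2 * m i}"
    using assms by auto
  then show thesis using that assms by (simp add: \<xi>_def E_def)
qed

text \<open>Only a lower and an upper vector of the same summand can pair nontrivially, which is
  \<open>b_\<xi>\<close>; otherwise both sides vanish.\<close>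

lemma X_selfadjoint_x:
  assumes i: "i \<in> I" "c \<in> {1..2 * m i}" and j: "j \<in> I" "d \<in> {1..2 * m j}"
  shows "b (X (x i c)) (x j d) = b (x i c) (X (x j d))"
proof -
  have low: "b (\<xi> i c) (x j d) = 0" if "i \<in> I" "c \<in> {1..m i}" "j \<in> I" "d \<in> {1..2 * m j}" "i \<noteq> j" for i c j d
  proof -
    have "\<xi> i c \<in> span (x i ` {1..m i})"
    proof (cases "q dvd c - 1")
      case True
      have "x i (c + d) \<in> x i ` {1..m i}" if "d < q" for d
      proof -
        have "c - 1 + d < m i"
          using True \<open>c \<in> {1..m i}\<close> that q_dvd[OF \<open>i \<in> I\<close>] by (intro add_lt_of_dvd) auto
        then show ?thesis using \<open>c \<in> {1..m i}\<close> by (intro imageI) simp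
      qed
      then show ?thesis
        using True \<open>c \<in> {1..m i}\<close> by (simp add: \<xi>_def) (intro span_sum span_base; simp)
    next
      case False
      then show ?thesis using \<open>c \<in> {1..m i}\<close> by (simp add: \<xi>_def span_zero)
    qed
    moreover have "span (x i ` {1..m i}) \<subseteq> {v. b v (x j d) = 0}"
      using that by (intro span_minimal) (auto simp: subspace_def b_left b_x)
    ultimately show ?thesis by auto
  qed
  have high: "b (\<xi> i c) (x j d) = 0"
    if h: "i \<in> I" "c \<in> {m i + 1..2 * m i}" "j \<in> I" "d \<in> {1..2 * m j}" "i \<noteq> j \<or> m j < d" for i c j d
  proof -
    obtain e where "\<xi> i c = x i e" "e \<in> {m i + 1..2 * m i}"
      using \<xi>_top[OF h(1,2)] by blast
    then show ?thesis using h by (auto simp: b_x)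
  qed
  have off: "b (\<xi> i c) (x j d) = 0"
    if "i \<in> I" "c \<in> {1..2 * m i}" "j \<in> I" "d \<in> {1..2 * m j}" "i \<noteq> j" for i c j d
    using that low[of i c j d] high[of i c j d] by (cases "c \<le> m i") auto
  have eq: "b (\<xi> i c) (x j d) = b (x i c) (\<xi> j d)"
  proof (cases "i = j")
    case False
    then have "b (\<xi> i c) (x j d) = 0" "b (\<xi> j d) (x i c) = 0"
      using off i j by auto
    then show ?thesis by (simp add: b_sym[of "x i c"])
  next
    case True
    consider "c \<le> m i" "d \<le> m i" | "c \<le> m i" "d > m i" | "c > m i" "d \<le> m i" | "c > m i" "d > m i"
      by linarith
    then show ?thesis
    proof cases
      case 1
      then show ?thesis
        using True i j isotropic_A \<xi>_A[of i c] \<xi>_A[of j d] x_A[of i c] x_A[of j d] by simp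
    next
      case 2
      then show ?thesis using True i j b_\<xi>[of i c d] by simp
    next
      case 3
      then have "b (\<xi> i d) (x i c) = b (x i d) (\<xi> i c)"
        using True i j by (intro b_\<xi>) auto
      then show ?thesis using True by (metis b_sym)
    next
      case 4
      then have "b (\<xi> i c) (x j d) = 0" "b (\<xi> j d) (x i c) = 0"
        using True i j by (auto intro!: high)
      then show ?thesis by (simp add: b_sym[of "x i c"])
    qed
  qed
  then show ?thesis using i j by (simp add: X_x)
qed

lemma X_sp: "X \<in> sp scale b"
proof -
  have "b (X v) z = b v (X z)" for v z
  proof -
    have *: "z \<in> {z. b (X (x i c)) z = b (x i c) (X z)}" if "i \<in> I" "c \<in> {1..2 * m i}" for i c z
    proof (rule all_induct)
      show "subspace {z. b (X (x i c)) z = b (x i c) (X z)}"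
        by (auto simp: subspace_def b_right X_add X_scale X_0)
      show "x j d \<in> {z. b (X (x i c)) z = b (x i c) (X z)}" if "j \<in> I" "d \<in> {1..2 * m j}" for j d
        using X_selfadjoint_x[OF \<open>i \<in> I\<close> \<open>c \<in> {1..2 * m i}\<close> that] by simp
    qed
    have "v \<in> {v. b (X v) z = b v (X z)}"
      by (rule all_induct) (use * in \<open>auto simp: subspace_def b_left b_right X_add X_scale X_0\<close>)
    then show ?thesis by simp
  qed
  then show ?thesis
    using vector_space_axioms by (simp add: sp_iff Vector_Spaces.linear_iff X_add X_scale)
qed

end

section \<open>A primitive of the identity\<close>

context symplectic_blocks
begin

text \<open>Below \<open>m i\<close> this is the choice of \<open>\<xi>\<close>. On
  \<open>V(2m)\<close>, the next \<open>q\<close> indices are tested against the upper half: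
  self-adjointness turns the pairing into a binomial coefficient \<open>(q * t - 1) choose a\<close>
  with \<open>a < q\<close>. It is odd, hence the same as for \<open>a = 0\<close>.\<close>

lemma X_w:
  assumes i: "i \<in> I" and j: "j < m i + q"
  shows "X (w i j) = w i (q * (j div q))"
proof (cases "j < m i")
  case True
  define E where "E = q * (j div q)"
  have "E \<le> j" by (simp add: E_def)
  have "X (w i j) = \<xi> i (2 * m i - j)"
    using i True by (simp add: w_top X_x)
  also have "\<dots> = x i (2 * m i - E)"
  proof -
    have "\<not> 2 * m i - j \<le> m i" "2 * m i - (2 * m i - j) = j" using True by auto
    then show ?thesis by (simp add: \<xi>_def E_def)
  qed
  also have "\<dots> = w i E"
    using True i \<open>E \<le> j\<close> by (simp add: w_top)
  finally show ?thesis by (simp add: E_def)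
next
  case False
  then obtain a where a: "j = m i + a" "a < q"
    using j by (auto simp: not_less dest!: le_Suc_ex)
  obtain r where r: "m i = q * r" using q_dvd[OF i] by (elim dvdE)
  have "q * (j div q) = m i"
    using a r q_pos by (simp add: a(1))
  moreover have "X (w i j) = w i (m i)"
  proof (cases "i \<in> W")
    case True
    then have "w i (m i) = 0" using i by (simp add: w_m)
    then show ?thesis using y_w[of a i "m i"] by (simp add: a add.commute X_0)
  next
    case False
    show ?thesis
    proof (rule eq_if_eq_on_top)
      show "X (w i j) \<in> A" using i a by (intro X_A w_A) auto
      show "w i (m i) \<in> A" using i by (intro w_A) auto
      fix i' c assume i': "i' \<in> I" and c: "c \<in> {m i' + 1..2 * m i'}"
      have Xsym: "b (X v) z = b v (X z)" for v z
        using X_sp by (simp add: sp_iff)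
      show "b (X (w i j)) (x i' c) = b (w i (m i)) (x i' c)"
      proof (cases "i = i'")
        case True
        define E where "E = q * ((2 * m i - c) div q)"
        have E: "E \<le> 2 * m i - c" by (simp add: E_def)
        have "E < q * r" using E c True r by auto
        then have k: "(2 * m i - c) div q < r" unfolding E_def by (simp only: mult_less_cancel1)
        define t where "t = r - (2 * m i - c) div q"
        have t: "0 < t" "m i - E = q * t"
          using k by (simp_all add: t_def E_def r diff_mult_distrib2)
        have "0 < q * t" using t by simp
        then have idx: "2 * m i - E = m i + 1 + (q * t - 1)" "q * t - 1 < m i"
          using t(2) by arith+
        have "b (X (w i j)) (x i' c) = b (w i (m i + a)) (x i (2 * m i - E))"
          using c i True by (simp add: Xsym X_x \<xi>_def E_def a)
        also have "\<dots> = of_nat ((q * t - 1) choose a)"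
          unfolding idx(1) using i False idx(2) by (rule b_w_low)
        also have "\<dots> = 1"
          using a(2) t(1) unfolding q_def by (intro of_nat_odd odd_choose_pred_mult_power_two)
        also have "1 = b (w i (m i)) (x i' c)"
          using b_w_low[of i "c - m i - 1" 0] i False c True by auto
        finally show ?thesis .
      next
        case ne: False
        obtain d where d: "\<xi> i' c = x i' d" "d \<in> {m i' + 1..2 * m i'}"
          using \<xi>_top[OF i' c] by blast
        have 0: "b (w i (m i + e)) (x i' d) = 0" if "d \<in> {1..2 * m i'}" for d e
        proof -
          \<comment> \<open>Powers of \<open>u\<close> keep the lower half of a summand inside
            itself, hence orthogonal to the other summands.\<close>
          have "b ((u ^^ l) (x i c)) (x i' d) = 0" if "c \<le> m i" for l c
            using that
          proof (induction l arbitrary: c)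
            case 0
            then show ?case using i i' ne \<open>d \<in> _\<close> by (cases "c = 0") (auto simp: b_x b_left)
          next
            case (Suc l)
            have pow_sum: "(u ^^ l) (sum f S) = (\<Sum>s\<in>S. (u ^^ l) (f s))" for f and S :: "nat set"
              by (induction l) (simp_all add: u_sum)
            have "(u ^^ Suc l) (x i c) = (\<Sum>d=1..c. (u ^^ l) (x i d))"
              using Suc.prems i by (simp add: funpow_swap1 u_low pow_sum)
            then show ?case using Suc by (simp add: b_sum_left del: funpow.simps)
          qed
          then show ?thesis using i False by (simp add: w_low_V del: funpow.simps)
        qed
        have "b (X (w i j)) (x i' c) = b (w i (m i + a)) (x i' d)"
          using c i' d by (simp add: Xsym X_x a)
        also have "\<dots> = 0" using d by (intro 0) auto
        also have "0 = b (w i (m i)) (x i' c)" using 0[of c 0] c by simp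
        finally show ?thesis .
      qed
    qed
  qed
  ultimately show ?thesis by simp
qed

text \<open>The value at \<open>X\<close> of the operator \<open>(L + R)\<^sup>q\<^sup>-\<^sup>1\<close>, for \<open>L\<close> and \<open>R\<close> the left and right
  multiplications by \<open>u - 1\<close>.\<close>

definition S :: "'v \<Rightarrow> 'v" where
  "S v = (\<Sum>l<q. (y ^^ l) (X ((y ^^ (q - 1 - l)) v)))"

text \<open>The exponent in the \<open>l\<close>-th summand is the unique number congruent to
  \<open>l\<close> modulo \<open>q\<close> among \<open>j, \<dots>, j + q - 1\<close>, so the sum is
  that of all \<open>y ^^ i\<close> for \<open>i < q\<close>, applied to
  \<open>w i j\<close>.\<close>

lemma S_top:
  assumes i: "i \<in> I" and j: "j < m i"
  shows "S (w i j) = (u ^^ (q - 1)) (w i j)"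
proof -
  define d where "d = j mod q"
  have d: "j = q * (j div q) + d" "d < q" by (simp_all add: d_def)
  have "S (w i j) = (\<Sum>l<q. w i (l + q * ((q - 1 - l + j) div q)))"
    unfolding S_def y_w
  proof (intro sum.cong refl)
    fix l assume "l \<in> {..<q}"
    then have "X (w i (q - 1 - l + j)) = w i (q * ((q - 1 - l + j) div q))"
      using i j by (intro X_w) auto
    then show "(y ^^ l) (X (w i (q - 1 - l + j))) = w i (l + q * ((q - 1 - l + j) div q))"
      by (simp add: y_w)
  qed
  also have "\<dots> = (\<Sum>l<q. w i (l + j))"
  \<comment> \<open>The witness sends \<open>l\<close> to the exponent of its summand minus
    \<open>j\<close>; the case split records whether a block boundary is crossed.\<close>
  proof (rule sum.reindex_bij_witness[where j = "\<lambda>l. if l < d then l + q - d else l - d"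
        and i = "\<lambda>l. if l + d < q then l + d else l + d - q"])
    fix l assume l: "l \<in> {..<q}"
    have dm: "(q * k + e) div q = k" if "e < q" for k e
      using that q_pos by simp
    have "(q - 1 - l + j) div q = (if l < d then Suc (j div q) else j div q)"
    proof (cases "l < d")
      case True
      have "q - 1 - l + j = q * Suc (j div q) + (d - 1 - l)" "d - 1 - l < q"
        using d l True by auto
      then show ?thesis by (simp only: dm True if_True)
    next
      case False
      have "q - 1 - l + j = q * (j div q) + (q - 1 - l + d)" "q - 1 - l + d < q"
        using d l False by auto
      then show ?thesis by (simp only: dm False if_False)
    qed
    moreover have "(if l < d then l + q - d else l - d) + j = l + q * (if l < d then Suc (j div q) else j div q)"
      using d l by auto
    ultimately show "w i ((if l < d then l + q - d else l - d) + j)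
        = w i (l + q * ((q - 1 - l + j) div q))"
      by simp
  qed (use d in auto)
  also have "\<dots> = (u ^^ (q - 1)) (w i j)"
    by (simp only: u_pow_pred_two[of \<alpha> "w i j", folded q_def] y_w)
  finally show ?thesis .
qed

text \<open>\<open>N\<close> splits into the commuting maps
  \<open>Z \<mapsto> y Z u\<inverse>\<close> and \<open>Z \<mapsto> Z (1 + u\<inverse>)\<close>.
  Evaluating at \<open>(u ^^ (q - 1)) v\<close> cancels every \<open>u\<inverse>\<close> and turns
  each \<open>1 + u\<inverse>\<close> into \<open>y\<close>.\<close>

lemma N_pow_pred: "(N ^^ (q - 1)) X ((u ^^ (q - 1)) v) = S v"
proof -
  define L R where "L Z = y \<circ> Z \<circ> ui" and "R Z = (\<lambda>v. Z v + Z (ui v))" for Z :: "'v \<Rightarrow> 'v"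
  have N_eq: "N = (\<lambda>Z. L Z + R Z)"
    by (auto simp: fun_eq_iff L_def R_def N_def Ad_def y_def ac_simps)
  have "((\<lambda>Z. L Z + R Z) ^^ (2 ^ \<alpha> - 1)) X
      = (\<Sum>l<2 ^ \<alpha>. (L ^^ l) ((R ^^ (2 ^ \<alpha> - 1 - l)) X))"
    by (rule frobenius_funpow_pred)
       (simp_all add: additive_def L_def R_def fun_eq_iff y_add ac_simps)
  then have "(N ^^ (q - 1)) X = (\<Sum>l<q. (L ^^ l) ((R ^^ (q - 1 - l)) X))"
    by (simp only: N_eq q_def[symmetric])
  moreover have L_pow: "(L ^^ l) Z v = (y ^^ l) (Z ((ui ^^ l) v))" for l Z v
    by (induction l arbitrary: v) (simp_all add: L_def funpow_swap1[of ui])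
  moreover have R_pow: "(R ^^ l) X v = X (((\<lambda>v. v + ui v) ^^ l) v)" for l v
  proof (induction l arbitrary: v)
    case (Suc l)
    have "((\<lambda>v. v + ui v) ^^ l) (ui v) = ui (((\<lambda>v. v + ui v) ^^ l) v)"
      by (induction l) (simp_all add: ui_add)
    then show ?case using Suc by (simp add: R_def X_add)
  qed simp
  moreover have p_pow: "((\<lambda>v. v + ui v) ^^ l) ((u ^^ l) v) = (y ^^ l) v" for l v
  proof (induction l arbitrary: v)
    case (Suc l)
    have "((\<lambda>v. v + ui v) ^^ Suc l) ((u ^^ Suc l) v)
        = ((\<lambda>v. v + ui v) ^^ l) ((u ^^ l) (u v) + ui ((u ^^ l) (u v)))"
      by (simp only: funpow_Suc_right comp_apply)
    also have "ui ((u ^^ l) (u v)) = (u ^^ l) v"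
      by (metis funpow_swap1 ui_u)
    also have "(u ^^ l) (u v) + (u ^^ l) v = (u ^^ l) (y v)"
      by (simp add: y_def u_pow_add)
    finally show ?case using Suc by (simp add: funpow_swap1)
  qed simp
  moreover have "(ui ^^ l) ((u ^^ (q - 1)) v) = (u ^^ (q - 1 - l)) v" if "l < q" for l
  proof -
    have "(u ^^ (q - 1)) v = (u ^^ l) ((u ^^ (q - 1 - l)) v)"
      using that by (simp flip: funpow_add comp_apply[of "u ^^ l"])
    then show ?thesis by (simp only: ui_u_pow)
  qed
  moreover have "sum F T z = (\<Sum>t\<in>T. F t z)" for F :: "nat \<Rightarrow> 'v \<Rightarrow> 'v" and T z
    by (induction T rule: infinite_finite_induct) auto
  ultimately show ?thesis
    by (simp add: S_def)
qed

text \<open>\<open>S_top\<close> gives the claim only on the upper halves, in the form that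
  \<open>C\<close> vanishes there. The symmetry \<open>bC\<close>, inherited from self-adjointness
  of \<open>T\<close>, carries it over to \<open>A\<close>, which \<open>C\<close> preserves and
  which is totally isotropic.\<close>

lemma id_in_N_pow: "(N ^^ (q - 1)) X = id"
proof -
  define T where "T = (N ^^ (q - 1)) X"
  define U where "U = u ^^ (q - 1)"
  define C where "C v = S v + U v" for v
  have T: "T \<in> sp scale b"
  proof -
    have "(N ^^ n) X \<in> sp scale b" for n
      using X_sp N_sp by (induction n) (auto simp: image_subset_iff)
    then show ?thesis by (simp add: T_def)
  qed
  have TU: "T (U v) = S v" for v
    unfolding T_def U_def by (rule N_pow_pred)
  have U_surj: "\<exists>z. v = U z" for v
    unfolding U_def using u_ui_pow by metis
  have bC: "b (C v) (U z) = b (U v) (C z)" for v z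
    using T by (simp add: C_def b_left b_right TU[symmetric] sp_iff)
  have C_A: "C v \<in> A" if "v \<in> A" for v
    unfolding C_def S_def U_def using that subspace_A
    by (intro subspace_add subspace_sum) (auto intro!: y_pow_A X_A u_pow_A)
  have C_top: "C (x i c) = 0" if "i \<in> I" "c \<in> {m i + 1..2 * m i}" for i c
  proof -
    have lt: "2 * m i - c < m i" using that by auto
    then have "w i (2 * m i - c) = x i c" using that by (simp add: w_top)
    then show ?thesis
      using S_top[OF that(1) lt] by (simp add: C_def U_def)
  qed
  have U_lin: "U (v + z) = U v + U z" "U (scale a v) = scale a (U v)" "U 0 = 0" for v z a
  proof -
    have "(u ^^ n) (scale a v) = scale a ((u ^^ n) v)" for n
      by (induction n) (simp_all add: u_scale)
    then show "U (v + z) = U v + U z" "U (scale a v) = scale a (U v)" "U 0 = 0"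
      by (simp_all add: U_def u_pow_add)
  qed
  have "C v = 0" if "v \<in> A" for v
  proof (rule nondegenerate)
    fix z'
    obtain z where z: "z' = U z" using U_surj by blast
    have "z \<in> {z. b (C v) (U z) = 0}"
    proof (rule all_induct)
      show "subspace {z. b (C v) (U z) = 0}"
        by (auto simp: subspace_def U_lin b_right)
      fix i c assume ic: "i \<in> I" "c \<in> {1..2 * m i}"
      show "x i c \<in> {z. b (C v) (U z) = 0}"
      proof (cases "c \<le> m i")
        case True
        then have "U (x i c) \<in> A" using ic unfolding U_def by (intro u_pow_A x_A) auto
        then show ?thesis using isotropic_A C_A[OF that] by simp
      next
        case False
        then have "C (x i c) = 0" using ic by (intro C_top) auto
        then show ?thesis by (simp add: bC b_right)
      qed
    qed
    then show "b (C v) z' = 0" by (simp add: z)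
  qed
  then have C_x: "C (x i c) = 0" if "i \<in> I" "c \<in> {1..2 * m i}" for i c
    using that C_top[of i c] x_A[of i c] by (cases "c \<le> m i") auto
  \<comment> \<open>The symmetry \<open>bC\<close> extends the vanishing from the basis vectors to
    all \<open>v\<close>, without appeal to linearity of \<open>C\<close>.\<close>
  have C_0: "C v = 0" for v
  proof (rule nondegenerate)
    fix z'
    obtain z where z: "z' = U z" using U_surj by blast
    have "z \<in> {z. b (C v) (U z) = 0}"
    proof (rule all_induct)
      show "subspace {z. b (C v) (U z) = 0}"
        by (auto simp: subspace_def U_lin b_right)
    qed (simp add: bC C_x b_right)
    then show "b (C v) z' = 0" by (simp add: z)
  qed
  have "T v = v" for v
  proof -
    obtain z where z: "v = U z" using U_surj by blast
    show ?thesis using C_0[of z] by (simp add: z TU C_def add_eq_0_iff_eq)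
  qed
  then show ?thesis by (simp add: T_def fun_eq_iff)
qed

end

section \<open>The decomposition of the Lie algebra\<close>

context symplectic_isometry
begin

lemma Ad_pow: "(Ad ^^ n) X = (u ^^ n) \<circ> X \<circ> (ui ^^ n)"
  by (induction n) (simp_all add: Ad_def fun_eq_iff funpow_swap1[of ui])

lemma u_pow_eq_id:
  assumes "unipotent u"
  obtains n where "u ^^ (2 ^ n) = id"
proof -
  have "(\<lambda>v. u v - v) = y" by (simp add: fun_eq_iff y_def minus_eq_plus)
  with assms obtain n where n: "(y ^^ n) v = 0" for v
    unfolding unipotent_def by auto
  have "2 ^ n = (2 ^ n - n) + n" using less_exp[of n] by simp
  then have "(y ^^ (2 ^ n)) v = (y ^^ (2 ^ n - n)) ((y ^^ n) v)" for v
    by (metis comp_apply funpow_add)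
  then have "u ^^ (2 ^ n) = id"
    using y_pow_two[of n] by (simp add: n fun_eq_iff add_eq_0_iff_eq)
  then show thesis by (rule that)
qed

text \<open>The order of \<open>u\<close> is a power of two, so the inverse of \<open>Ad\<close> is
  itself a power of \<open>Ad\<close> and preserves \<open>M\<close>.\<close>

lemma group_algebra_module_operator_module:
  assumes "unipotent u" and M: "module.subspace scale_fun M" and NM: "N ` M \<subseteq> M"
  shows "group_algebra_module u (operator_module scale_fun M (\<lambda>X. X + N X))"
proof -
  interpret F: vector_space scale_fun by (rule vector_space_fun)
  have Ad: "X + N X = Ad X" for X
    by (simp add: Ad_eq[symmetric] Ad_def)
  have Ad_M: "Ad X \<in> M" if "X \<in> M" for X
    unfolding Ad[symmetric] using that NM by (intro F.subspace_add M) auto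
  have Ad_pow_M: "(Ad ^^ n) X \<in> M" if "X \<in> M" for X n
    using that Ad_M by (induction n) auto
  have ui_pow: "ui ^^ n = id" if "u ^^ n = id" for n
    using ui_u_pow[of n] that by (simp add: fun_eq_iff)
  obtain n where n: "u ^^ (2 ^ n) = id" using u_pow_eq_id[OF assms(1)] .
  have inj: "inj_on Ad M"
  proof (rule inj_onI)
    fix X Y assume "Ad X = Ad Y"
    then have "Ad X (u v) = Ad Y (u v)" for v by simp
    then have "ui (u (X v)) = ui (u (Y v))" for v by (simp add: Ad_def)
    then show "X = Y" by (simp add: fun_eq_iff)
  qed
  have surj: "X \<in> Ad ` M" if "X \<in> M" for X
  proof -
    have "Ad ((Ad ^^ (2 ^ n - 1)) X) = (Ad ^^ (2 ^ n)) X"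
      using funpow.simps(2)[of "2 ^ n - 1" Ad] by (simp del: funpow.simps)
    also have "\<dots> = X" by (simp add: Ad_pow n ui_pow)
    finally show ?thesis using Ad_pow_M[OF that] by (metis image_eqI)
  qed
  have lin: "Ad (X + Y) = Ad X + Ad Y" "Ad (scale_fun c X) = scale_fun c (Ad X)" for X Y c
    by (simp_all add: Ad_def fun_eq_iff u_add u_scale)
  show ?thesis
    unfolding group_algebra_module_def operator_module_simps Ad
  proof (intro conjI allI impI ballI)
    show "Module.module class_ring (operator_module scale_fun M Ad)"
      by (rule F.module_operator_module[OF M])
    show "Ad \<in> module_hom class_ring (operator_module scale_fun M Ad) (operator_module scale_fun M Ad)"
      using Ad_M lin by (simp add: module_hom_def)
    show "bij_betw Ad M M"
      using inj surj Ad_M by (auto simp: bij_betw_def)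
    show "(Ad ^^ n) X = X" if "u ^^ n = id" for n X
      using that by (simp add: Ad_pow ui_pow)
  qed
qed

lemma symplectic_blocks_of_decomposition:
  assumes decomp: "orthogonal_decomposition scale b u t m s k"
    and pos: "\<forall>i\<in>{1..t}. m i \<ge> 1" "\<forall>j\<in>{1..s}. k j \<ge> 1"
    and alpha: "(\<forall>i\<in>{1..t}. 2 ^ \<alpha> dvd m i) \<and> (\<forall>j\<in>{1..s}. 2 ^ \<alpha> dvd k j)"
  shows "\<exists>x. symplectic_blocks scale Basis b u (Inl ` {1..t} \<union> Inr ` {1..s}) (Inl ` {1..t})
    (case_sum m k) x (2 ^ \<alpha>) \<alpha>"
proof -
  let ?I = "Inl ` {1..t} \<union> Inr ` {1..s} :: (nat + nat) set"
  let ?W = "Inl ` {1..t} :: (nat + nat) set"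
  let ?m = "case_sum m k"
  obtain U where U: "orthogonal_direct_sum scale b ?I U"
    and W: "\<And>i. i \<in> {1..t} \<Longrightarrow> is_W scale b u (m i) (U (Inl i))"
    and V: "\<And>j. j \<in> {1..s} \<Longrightarrow> is_V scale b u (k j) (U (Inr j))"
    using decomp unfolding orthogonal_decomposition_def by blast
  \<comment> \<open>A description common to both kinds of summand, which differ only in the image of
    the vector of index \<open>?m i + 1\<close>.\<close>
  define P where "P i x \<longleftrightarrow> hyperbolic_basis scale b (U i) (2 * ?m i) x \<and>
      (\<forall>c. 1 \<le> c \<and> c \<le> ?m i \<longrightarrow> u (x c) = (\<Sum>d=1..c. x d)) \<and>
      (\<forall>c. ?m i + 1 < c \<and> c \<le> 2 * ?m i \<longrightarrow> u (x c) = x c + x (c - 1)) \<and>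
      u (x (?m i + 1)) = x (?m i + 1) + (if i \<in> ?W then 0 else u (x (?m i)))" for i x
  have ex: "\<exists>x. P i x" if "i \<in> ?I" for i
  proof (cases i)
    case (Inl a)
    then have a: "a \<in> {1..t}" using that by auto
    obtain x where x: "hyperbolic_basis scale b (U (Inl a)) (2 * m a) x" "u (x 1) = x 1"
      "\<And>c. 1 < c \<and> c \<le> m a \<Longrightarrow> u (x c) = (\<Sum>d=1..c. x d)" "u (x (m a + 1)) = x (m a + 1)"
      "\<And>c. m a + 1 < c \<and> c \<le> 2 * m a \<Longrightarrow> u (x c) = x c + x (c - 1)"
      using W[OF a] unfolding is_W_def by blast
    have "u (x c) = (\<Sum>d=1..c. x d)" if "1 \<le> c" "c \<le> m a" for c
      using that x(2) x(3)[of c] by (cases "c = 1") auto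
    then have "P i x" using x a by (simp add: P_def Inl)
    then show ?thesis by blast
  next
    case (Inr a)
    then have a: "a \<in> {1..s}" using that by auto
    obtain x where x: "hyperbolic_basis scale b (U (Inr a)) (2 * k a) x" "u (x 1) = x 1"
      "\<And>c. 1 < c \<and> c \<le> k a + 1 \<Longrightarrow> u (x c) = (\<Sum>d=1..c. x d)"
      "\<And>c. k a + 1 < c \<and> c \<le> 2 * k a \<Longrightarrow> u (x c) = x c + x (c - 1)"
      using V[OF a] unfolding is_V_def by blast
    have low: "u (x c) = (\<Sum>d=1..c. x d)" if "1 \<le> c" "c \<le> k a + 1" for c
      using that x(2) x(3)[of c] by (cases "c = 1") auto
    have ka: "1 \<le> k a" using pos(2) a by blast
    \<comment> \<open>In \<open>V(2k)\<close> the partial sum up to \<open>k + 1\<close> is its last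
      term plus the partial sum up to \<open>k\<close>.\<close>
    have "u (x (k a + 1)) = x (k a + 1) + u (x (k a))"
      using low[of "k a + 1"] low[of "k a"] ka by (simp add: add.commute)
    then have "P i x" using x low by (auto simp: P_def Inr)
    then show ?thesis by blast
  qed
  define x where "x i c = (if c = 0 then 0 else (SOME x. P i x) c)" for i and c :: nat
  have P: "P i (SOME x. P i x)" if "i \<in> ?I" for i
    using someI_ex[OF ex[OF that]] .
  have x_eq: "x i c = (SOME x. P i x) c" if "c \<noteq> 0" for i c
    using that by (simp add: x_def)
  have m_pos: "0 < ?m i" if "i \<in> ?I" for i
    using that pos by force
  have span_U: "span (x i ` {1..2 * ?m i}) = U i" if "i \<in> ?I" for i
  proof -
    have "x i ` {1..2 * ?m i} = (SOME x. P i x) ` {1..2 * ?m i}"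
      by (intro image_cong) (auto simp: x_eq)
    then show ?thesis using P[OF that] by (simp add: P_def hyperbolic_basis_def)
  qed
  have b_same: "b (x i c) (x i d) = (if c + d = 2 * ?m i + 1 then 1 else 0)"
    if "i \<in> ?I" "c \<in> {1..2 * ?m i}" "d \<in> {1..2 * ?m i}" for i c d
    using P[OF that(1)] that(2,3) by (simp add: P_def hyperbolic_basis_def x_eq)
  have x_U: "x i c \<in> U i" if "i \<in> ?I" "c \<in> {1..2 * ?m i}" for i c
    using span_U[OF that(1)] that(2) span_base by blast
  have "symplectic_blocks scale Basis b u ?I ?W ?m x (2 ^ \<alpha>) \<alpha>"
  proof
    show "finite ?I" by simp
    show "(2::nat) ^ \<alpha> = 2 ^ \<alpha>" ..
    fix i j :: "nat + nat" and c d
    assume i: "i \<in> ?I"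
    show "0 < ?m i" using m_pos[OF i] .
    show "2 ^ \<alpha> dvd ?m i" using i alpha by auto
    show "b (x i c) (x j d) = (if i = j \<and> c + d = 2 * ?m i + 1 then 1 else 0)"
      if "j \<in> ?I" "c \<in> {1..2 * ?m i}" "d \<in> {1..2 * ?m j}"
    proof (cases "i = j")
      case True
      then show ?thesis using b_same[OF i] that by simp
    next
      case False
      then have "b (x i c) (x j d) = 0"
        using U i that x_U[OF i] x_U[OF that(1)] unfolding orthogonal_direct_sum_def by blast
      then show ?thesis using False by simp
    qed
    show "u (x i c) = (\<Sum>d=1..c. x i d)" if "c \<le> ?m i"
    proof (cases "c = 0")
      case False
      then have "u (x i c) = (\<Sum>d=1..c. (SOME x. P i x) d)"
        using P[OF i] that by (simp add: P_def x_eq)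
      also have "\<dots> = (\<Sum>d=1..c. x i d)" by (intro sum.cong) (auto simp: x_eq)
      finally show ?thesis .
    qed (simp add: x_def)
    show "u (x i c) = x i c + x i (c - 1)" if "?m i + 1 < c" "c \<le> 2 * ?m i"
      using P[OF i] that by (simp add: P_def x_eq)
    show "u (x i (?m i + 1)) = x i (?m i + 1) + (if i \<in> ?W then 0 else u (x i (?m i)))"
      using P[OF i] m_pos[OF i] by (simp add: P_def x_eq)
  next
    show "x i 0 = 0" for i by (simp add: x_def)
    show "span (\<Union>i\<in>?I. x i ` {1..2 * ?m i}) = UNIV"
    proof (intro equalityI subset_UNIV subsetI)
      fix v
      obtain f where f: "\<forall>i\<in>?I. f i \<in> U i" "v = (\<Sum>i\<in>?I. f i)"
        using U unfolding orthogonal_direct_sum_def by metis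
      have "f i \<in> span (\<Union>i\<in>?I. x i ` {1..2 * ?m i})" if "i \<in> ?I" for i
      proof -
        have "f i \<in> span (x i ` {1..2 * ?m i})" using f(1) span_U[OF that] that by blast
        moreover have "x i ` {1..2 * ?m i} \<subseteq> (\<Union>i\<in>?I. x i ` {1..2 * ?m i})"
          using that by (rule UN_upper)
        ultimately show ?thesis using span_mono by (meson subsetD)
      qed
      then show "v \<in> span (\<Union>i\<in>?I. x i ` {1..2 * ?m i})"
        unfolding f(2) by (rule span_sum)
    qed
  qed
  then show ?thesis by blast
qed

end

theorem proposition9p5:
  fixes scale :: "'k::alg_closed_field \<Rightarrow> 'v::ab_group_add \<Rightarrow> 'v"
    and Basis :: "'v set"
    and b :: "'v \<Rightarrow> 'v \<Rightarrow> 'k"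
    and u :: "'v \<Rightarrow> 'v"
    and l t s \<alpha> :: nat
    and m k :: "nat \<Rightarrow> nat"
  assumes char: "CHAR('k) = 2"
    and V: "symplectic_space scale Basis b"
    and dim: "vector_space.dim scale (UNIV :: 'v set) = 2 * l"
    and u: "u \<in> Sp scale b" "unipotent u"
    and pos: "\<forall>i\<in>{1..t}. m i \<ge> 1" "\<forall>j\<in>{1..s}. k j \<ge> 1"
    and decomp: "orthogonal_decomposition scale b u t m s k"
    and alpha: "(\<forall>i\<in>{1..t}. 2 ^ \<alpha> dvd m i) \<and> (\<forall>j\<in>{1..s}. 2 ^ \<alpha> dvd k j)"
    and alpha_max: "\<forall>\<beta>. (\<forall>i\<in>{1..t}. 2 ^ \<beta> dvd m i) \<and> (\<forall>j\<in>{1..s}. 2 ^ \<beta> dvd k j) \<longrightarrow> \<beta> \<le> \<alpha>"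
  shows "\<exists>V' :: ('k, 'v \<Rightarrow> 'v) umodule.
           group_algebra_module u V' \<and>
           umodule_iso (sp_module scale b u) (umodule_sum (jordan_module (2 ^ \<alpha>)) V') \<and>
           umodule_iso (umodule_quotient (sp_module scale b u) (lie_center (sp scale b)))
             (umodule_sum (jordan_module (2 ^ \<alpha> - 1)) V')"
proof -
  interpret symplectic_isometry scale Basis b u
    using V u(1) char by (simp add: symplectic_isometry_def symplectic_isometry_axioms_def)
  let ?I = "Inl ` {1..t} \<union> Inr ` {1..s} :: (nat + nat) set"
  obtain x where "symplectic_blocks scale Basis b u ?I (Inl ` {1..t}) (case_sum m k) x (2 ^ \<alpha>) \<alpha>"
    using symplectic_blocks_of_decomposition[OF decomp pos alpha] by blast
  then interpret B: symplectic_blocks scale Basis b u ?I "Inl ` {1..t}" "case_sum m k" x "2 ^ \<alpha>" \<alpha> .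
  \<comment> \<open>Maximality of \<alpha> supplies a summand with odd quotient; it also excludes an
    empty decomposition, for which every exponent would be admissible.\<close>
  have "\<exists>i\<in>?I. \<not> 2 ^ Suc \<alpha> dvd case_sum m k i"
  proof (rule ccontr)
    assume "\<not> ?thesis"
    then have all: "2 ^ Suc \<alpha> dvd case_sum m k i" if "i \<in> ?I" for i
      using that by blast
    have "2 ^ Suc \<alpha> dvd m a" if "a \<in> {1..t}" for a
      using all[of "Inl a"] that by simp
    moreover have "2 ^ Suc \<alpha> dvd k a" if "a \<in> {1..s}" for a
      using all[of "Inr a"] that by simp
    ultimately have "(\<forall>i\<in>{1..t}. 2 ^ Suc \<alpha> dvd m i) \<and> (\<forall>j\<in>{1..s}. 2 ^ Suc \<alpha> dvd k j)"
      by blast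
    then have "Suc \<alpha> \<le> \<alpha>" using alpha_max by blast
    then show False by simp
  qed
  then obtain i where i: "i \<in> ?I" "\<not> 2 ^ Suc \<alpha> dvd case_sum m k i" by blast
  obtain r where r: "case_sum m k i = 2 ^ \<alpha> * r" using B.q_dvd[OF i(1)] by (elim dvdE)
  have "odd r" using i(2) unfolding r by (auto elim!: evenE)
  note notin = B.id_notin_N_pow[OF i(1) r this]
  define h :: nat where "h = 2 ^ \<alpha> - 1"
  have h: "Suc h = 2 ^ \<alpha>" by (simp add: h_def)
  have top: "(N ^^ h) B.X = id" unfolding h_def by (rule B.id_in_N_pow)
  interpret F: vector_space scale_fun by (rule vector_space_fun)
  have nil: "(N ^^ Suc h) B.X = 0" by (simp only: funpow.simps comp_apply top N_id)
  \<comment> \<open>The chain starts at \<open>B.X\<close> and ends in the identity after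
    \<open>h\<close> steps; \<open>notin\<close> says that the identity is not reached one step
    later.\<close>
  obtain \<phi> where \<phi>: "Vector_Spaces.linear scale_fun (*) \<phi>"
    "\<And>Z. Z \<in> sp scale b \<Longrightarrow> \<phi> ((N ^^ Suc h) Z) = 0"
    "\<And>i. i \<le> h \<Longrightarrow> \<phi> ((N ^^ i) B.X) = (if i = h then 1 else 0)"
    using F.dual_functional_of_chain[OF linear_N subspace_sp N_sp nil] notin
    unfolding top h by blast
  define M where "M = {Z \<in> sp scale b. \<forall>i\<le>h. \<phi> ((N ^^ i) Z) = 0}"
  note split = F.jordan_chain_splits_off[OF linear_N subspace_sp N_sp B.X_sp nil \<phi>, folded M_def]
  have sp_module: "sp_module scale b u = operator_module scale_fun (sp scale b) (\<lambda>Z. Z + N Z)"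
  proof -
    have "(\<lambda>(X :: 'v \<Rightarrow> 'v) Y v. X v + Y v) = (+)" "(\<lambda>v::'v. 0::'v) = 0"
      by (simp_all add: fun_eq_iff)
    then show ?thesis by (simp add: sp_module_def operator_module_def Ad_eq)
  qed
  show ?thesis
  proof (intro exI[of _ "operator_module scale_fun M (\<lambda>Z. Z + N Z)"] conjI)
    show "group_algebra_module u (operator_module scale_fun M (\<lambda>Z. Z + N Z))"
      using u(2) split(1,2) by (rule group_algebra_module_operator_module)
    show "umodule_iso (sp_module scale b u)
        (umodule_sum (jordan_module (2 ^ \<alpha>)) (operator_module scale_fun M (\<lambda>Z. Z + N Z)))"
      unfolding sp_module h[symmetric] by (rule split(3))
    show "umodule_iso (umodule_quotient (sp_module scale b u) (lie_center (sp scale b)))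
        (umodule_sum (jordan_module (2 ^ \<alpha> - 1)) (operator_module scale_fun M (\<lambda>Z. Z + N Z)))"
      \<comment> \<open>The line factored out is spanned by \<open>(N ^^ h) B.X = id\<close>, hence
        it is the center.\<close>
      using split(4) by (simp only: sp_module lie_center_sp h_def[symmetric] top)
  qed
qed

end
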